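(* Let $f\in\mathcal R$ be a $P$-linear map, where $P$ is a cycle of $f$. Then $f$ is exact if and only if $P$ has no block structure.
   Context: Triod: $\tau=\{z\in\mathbb C: z^3\in[0,1]\}$, with branching point $a=0$; the branches of $\tau$ are the three components of $\tau\setminus\{a\}$. For $S\subset\tau$, the convex hull $[S]$ is the smallest closed connected subset of $\tau$ containing $S$. Maps and cycles: $\mathcal U$ is the set of continuous maps $f:\tau\to\tau$ whose unique fixed point is $a$. A cycle of $f$ is a periodic orbit $P\subset\tau\setminus\{a\}$; its period is its cardinality. A cycle $P$ of $f$ and a cycle $Q$ of $g$ are equivalent if there is a homeomorphism $h:[P]\to[Q]$ preserving each branch, with $h(P)=Q$ and $h\circ f=g\circ h$ on $P$; an equivalence class is called a pattern, and a cycle exhibits its class. A pattern $A$ forces a pattern $B$ if every $f\in\mathcal U$ having a cycle of pattern $A$ also has a cycle of pattern $B$. A cycle (or pattern) is primitive if its points lie on pairwise different branches. A pattern is regular if it forces no primitive pattern of period $2$; a cycle is regular if its pattern is. $\mathcal R$ is the set of $f\in\mathcal U$ all of whose cycles are regular. $P$-linear maps: given a cycle $P$, the $P$-linear map is the continuous map of $\tau$ to itself which fixes $a$, acts on $P$ by the given cyclic permutation, is affine on every component of $[P]\setminus(P\cup\{a\})$ and is constant on every component of $\tau\setminus[P]$. Exactness: a continuous map $F:X\to X$ is topologically exact if for every nonempty open $U\subset X$ there is $n\in\mathbb N$ with $F^n(U)=X$. A $P$-linear map $f$ is called exact if its restriction $f|_{[P]}:[P]\to[P]$ is topologically exact. Block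 structure: a cycle $P$ of the $P$-linear map $f$ has a block structure over a cycle $Q$ of $f$ of period $m$ if $P$ is a disjoint union $P=P_1\cup\dots\cup P_m$ of sets (blocks) of equal cardinality such that (1) the convex hulls $[P_i]$ are pairwise disjoint and none contains $a$; (2) each $[P_i]$ contains exactly one point $x_i$ of $Q$; (3) whenever $f(x_i)=x_j$, $f(P_i)=P_j$. $P$ has a block structure if it has one over some cycle $Q$ with blocks of cardinality at least $2$.
   Formalization: The formal theorem adds that P is not primitive: for a primitive cycle of period 3, such as P the cube roots of unity with f a rotation by 120 degrees, f is in R and P has no block structure, yet f is not exact. *)

theory Defs
  imports "HOL-Analysis.Analysis"
begin

section \<open>The triod\<close>

definition triod :: "complex set" where
  "triod = {z. z ^ 3 \<in> complex_of_real ` {0..1}}"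

definition branches :: "complex set set" where
  "branches = components (triod - {0})"

definition triod_hull :: "complex set \<Rightarrow> complex set" where
  "triod_hull S = \<Inter> {K. K \<subseteq> triod \<and> closed K \<and> connected K \<and> S \<subseteq> K}"

text \<open>The length of the arc joining two points of the triod; two points of different
  branches are joined through the branching point.\<close>

definition tdist :: "complex \<Rightarrow> complex \<Rightarrow> real" where
  "tdist x y = (if \<exists>B\<in>branches. x \<in> B \<and> y \<in> B then cmod (x - y) else cmod x + cmod y)"


section \<open>Maps, cycles and patterns\<close>

text \<open>Maps of the triod are total functions on the complex plane; only their values on
  the triod matter.\<close>

definition triod_maps :: "(complex \<Rightarrow> complex) set" where
  "triod_maps = {f. continuous_on triod f \<and> f ` triod \<subseteq> triod \<and> {z \<in> triod. f z = z} = {0}}"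

definition is_cycle :: "(complex \<Rightarrow> complex) \<Rightarrow> complex set \<Rightarrow> bool" where
  "is_cycle f P \<longleftrightarrow> P \<subseteq> triod - {0} \<and>
     (\<exists>x\<in>P. \<exists>n>0. (f ^^ n) x = x \<and> P = range (\<lambda>k. (f ^^ k) x))"

definition cycle_equiv ::
    "(complex \<Rightarrow> complex) \<Rightarrow> complex set \<Rightarrow> (complex \<Rightarrow> complex) \<Rightarrow> complex set \<Rightarrow> bool" where
  "cycle_equiv f P g Q \<longleftrightarrow>
     (\<exists>h h'. homeomorphism (triod_hull P) (triod_hull Q) h h' \<and>
        (\<forall>B\<in>branches. h ` (triod_hull P \<inter> B) = triod_hull Q \<inter> B) \<and>
        h ` P = Q \<and> (\<forall>x\<in>P. h (f x) = g (h x)))"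

type_synonym pattern = "((complex \<Rightarrow> complex) \<times> complex set) set"

definition pattern_of :: "(complex \<Rightarrow> complex) \<Rightarrow> complex set \<Rightarrow> pattern" where
  "pattern_of f P = {(g, Q). g \<in> triod_maps \<and> is_cycle g Q \<and> cycle_equiv f P g Q}"

definition patterns :: "pattern set" where
  "patterns = {pattern_of f P | f P. f \<in> triod_maps \<and> is_cycle f P}"

definition forces :: "pattern \<Rightarrow> pattern \<Rightarrow> bool" where
  "forces A B \<longleftrightarrow> (\<forall>f\<in>triod_maps. (\<exists>P. (f, P) \<in> A) \<longrightarrow> (\<exists>Q. (f, Q) \<in> B))"

definition primitive_cycle :: "complex set \<Rightarrow> bool" where
  "primitive_cycle P \<longleftrightarrow>
     (\<forall>x\<in>P. \<forall>y\<in>P. x \<noteq> y \<longrightarrow> \<not> (\<exists>B\<in>branches. x \<in> B \<and> y \<in> B))"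

definition primitive_pattern :: "pattern \<Rightarrow> bool" where
  "primitive_pattern A \<longleftrightarrow> (\<forall>(f, P)\<in>A. primitive_cycle P)"

definition has_period :: "pattern \<Rightarrow> nat \<Rightarrow> bool" where
  "has_period A n \<longleftrightarrow> (\<forall>(f, P)\<in>A. card P = n)"

definition regular_pattern :: "pattern \<Rightarrow> bool" where
  "regular_pattern A \<longleftrightarrow>
     \<not> (\<exists>B\<in>patterns. primitive_pattern B \<and> has_period B 2 \<and> forces A B)"

definition regular_maps :: "(complex \<Rightarrow> complex) set" where
  "regular_maps =
     {f \<in> triod_maps. \<forall>P. is_cycle f P \<longrightarrow> regular_pattern (pattern_of f P)}"


section \<open>Linear maps, exactness and block structures\<close>

text \<open>Affinity refers to the arc length of the triod and not to the linear structure of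
  the plane: the image of an interval may pass through the branching point.  A map from an
  interval to a tree that multiplies all distances by a constant is the parametrization of
  an arc (or a point) with constant speed.\<close>

definition affine_on_triod :: "complex set \<Rightarrow> (complex \<Rightarrow> complex) \<Rightarrow> bool" where
  "affine_on_triod J f \<longleftrightarrow> (\<exists>c. \<forall>x\<in>J. \<forall>y\<in>J. tdist (f x) (f y) = c * tdist x y)"

text \<open>For a cycle \<open>P\<close> of \<open>f\<close>; the cyclic permutation of \<open>P\<close> is the one induced by \<open>f\<close>.\<close>

definition P_linear :: "complex set \<Rightarrow> (complex \<Rightarrow> complex) \<Rightarrow> bool" where
  "P_linear P f \<longleftrightarrow> continuous_on triod f \<and> f ` triod \<subseteq> triod \<and> f 0 = 0 \<and>
     (\<forall>J\<in>components (triod_hull P - (P \<union> {0})). affine_on_triod J f) \<and>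
     (\<forall>J\<in>components (triod - triod_hull P). f constant_on J)"

definition topologically_exact :: "'a::topological_space set \<Rightarrow> ('a \<Rightarrow> 'a) \<Rightarrow> bool" where
  "topologically_exact X F \<longleftrightarrow>
     (\<forall>U. openin (top_of_set X) U \<and> U \<noteq> {} \<longrightarrow> (\<exists>n. (F ^^ n) ` U = X))"

text \<open>The blocks and the points of \<open>Q\<close> are indexed by \<open>{..<m}\<close>, where \<open>m\<close> is the period of
  \<open>Q\<close>; \<open>k\<close> is the common cardinality of the blocks.\<close>

definition block_structure_over ::
    "(complex \<Rightarrow> complex) \<Rightarrow> complex set \<Rightarrow> complex set \<Rightarrow> nat \<Rightarrow> bool" where
  "block_structure_over f P Q k \<longleftrightarrow> is_cycle f Q \<and>
     (\<exists>(Bl :: nat \<Rightarrow> complex set) (x :: nat \<Rightarrow> complex). let m = card Q in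
        P = (\<Union>i<m. Bl i) \<and> disjoint_family_on Bl {..<m} \<and> (\<forall>i<m. card (Bl i) = k) \<and>
        disjoint_family_on (\<lambda>i. triod_hull (Bl i)) {..<m} \<and>
        (\<forall>i<m. 0 \<notin> triod_hull (Bl i)) \<and>
        (\<forall>i<m. triod_hull (Bl i) \<inter> Q = {x i}) \<and>
        (\<forall>i<m. \<forall>j<m. f (x i) = x j \<longrightarrow> f ` Bl i = Bl j))"

text \<open>Blocks have at least two points.  Hence a primitive cycle of period 3 has no block
  structure, although its linear map permutes three segments homeomorphically and is not
  exact; equivalences between exactness and the lack of a block structure have to exclude
  this degenerate case.\<close>

definition has_block_structure :: "(complex \<Rightarrow> complex) \<Rightarrow> complex set \<Rightarrow> bool" where
  "has_block_structure f P \<longleftrightarrow> (\<exists>Q k. 2 \<le> k \<and> block_structure_over f P Q k)"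

end

theory Submission
  imports Defs
begin

text \<open>
  Write \<open>V\<close> for the points of \<open>P\<close> together with the branching point \<open>0\<close>. They cut the tree \<open>[P]\<close>
  into edges, and \<open>f\<close> stretches every edge by a constant factor onto an arc between two points
  of \<open>V\<close>. Membership in \<open>regular_maps\<close> enters through two consequences: \<open>f\<close> has no fixed
  point besides \<open>0\<close>, and no cycle of period 2 that meets two branches.

  If \<open>P\<close> has a block structure, the hulls of the blocks form an invariant set that has interior
  points and does not contain \<open>0\<close>; so the images of an open piece of a hull never cover \<open>[P]\<close>
  (\<open>not_exact_if_block_structure\<close>).

  For the converse, blocks are obtained as the traces on \<open>P\<close> of connected sets that avoid \<open>0\<close> and
  are permuted by \<open>f\<close> in a weak sense; the cycle \<open>Q\<close> then comes from Brouwer's fixed point theorem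
  (\<open>has_block_structure_if_family\<close>). There are three sources of such sets.

  \<^item> The absence of other fixed points and of 2-cycles forces \<open>f\<close> to permute the three branches
    cyclically near \<open>0\<close> (\<open>dirs_eq_orbit\<close>). If all of \<open>P\<close> follows this rotation, the branches are
    such sets (\<open>has_block_structure_if_rotating\<close>).
  \<^item> If two points have the property that no point of \<open>V\<close> ever separates their images, compare the
    arc between the images with the edge that contains it. The ratio of the lengths does not
    decrease, is at most 1, and changes by finitely many possible factors; so it is eventually
    constant, which means that from then on edges are mapped onto edges. The components of the
    union of these edges are such sets (\<open>unseparated_forever_imp_edge_loop\<close>,
    \<open>has_block_structure_if_edge_loop\<close>).
  \<^item> If an invariant set avoids \<open>0\<close> and joins two points of \<open>P\<close>, its components are such sets
    (\<open>has_block_structure_if_invariant_set\<close>).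

  Now let there be no block structure. Because \<open>P\<close> does not follow the rotation, the edges at
  \<open>0\<close> mix: the images of each of them eventually cover \<open>[P]\<close> (\<open>stem_covers\<close>). Because vertices
  separate, the images of an arc eventually contain a point of \<open>V\<close> besides the image of an end
  point. If these images never contained \<open>0\<close>, their union would be an invariant set of the third
  kind. So some image contains \<open>0\<close> and another point; a vertex separates the images of these two
  later on, whereby an edge at \<open>0\<close> is covered, and after that all of \<open>[P]\<close>
  (\<open>exact_if_no_block_structure\<close>).
\<close>

section \<open>Coordinates on the triod\<close>

text \<open>
  A branch consists of the nonzero points with a given value of \<open>sgn\<close>; so the branches are named
  by the cube roots of unity.
\<close>

definition dirs :: "complex set" where
  "dirs = {w. w ^ 3 = 1}"

text \<open>
  The retraction of the triod onto the closed branch of direction \<open>w\<close>, measured by the modulus.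
  On the other two branches \<open>Re (z * cnj w)\<close> is minus half the modulus, so that cutting it off
  at \<open>0\<close> gives a map that is visibly continuous.
\<close>

definition coord :: "complex \<Rightarrow> complex \<Rightarrow> real" where
  "coord w z = max 0 (Re (z * cnj w))"

lemma card_dirs: "card dirs = 3" and finite_dirs: "finite dirs"
  using card_nth_roots[of 1 3] finite_nth_roots[of 3 1] by (auto simp: dirs_def)

lemma norm_dirs: "w \<in> dirs \<Longrightarrow> cmod w = 1"
  unfolding dirs_def using power_eq_1_iff[of w 3] by auto

lemma dirs_nonzero: "w \<in> dirs \<Longrightarrow> w \<noteq> 0"
  by (auto simp: dirs_def)

lemma dirs_mult_cnj: "w \<in> dirs \<Longrightarrow> w * cnj w = 1"
  by (simp add: complex_norm_square[symmetric] norm_dirs flip: of_real_power)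

text \<open>
  The quotient \<open>u = w' * cnj w\<close> is a cube root of unity other than \<open>1\<close>, whence \<open>u + 1 + cnj u = 0\<close>.
\<close>

lemma Re_dirs_mult_cnj:
  assumes "w \<in> dirs" "w' \<in> dirs" "w' \<noteq> w"
  shows "Re (w' * cnj w) = - 1 / 2"
proof -
  define u where "u = w' * cnj w"
  have "(cnj w) ^ 3 = 1"
    using assms(1) by (simp add: dirs_def flip: complex_cnj_power)
  then have u3: "u ^ 3 = 1"
    using assms(2) by (simp add: u_def dirs_def power_mult_distrib)
  have "u \<noteq> 1"
  proof
    assume "u = 1"
    then have "w' * (w * cnj w) = w"
      by (simp add: u_def mult_ac)
    then show False
      using dirs_mult_cnj[OF assms(1)] assms(3) by simp
  qed
  moreover have "(u - 1) * (u ^ 2 + u + 1) = u ^ 3 - 1"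
    by (simp add: algebra_simps power2_eq_square power3_eq_cube)
  ultimately have "u ^ 2 + u + 1 = 0"
    using u3 by simp
  moreover have uu: "u * cnj u = 1"
    using dirs_mult_cnj[of u] u3 by (simp add: dirs_def)
  moreover have "(u ^ 2 + u + 1) * cnj u = u * (u * cnj u) + u * cnj u + cnj u"
    by (simp add: algebra_simps power2_eq_square)
  ultimately have "u + 1 + cnj u = 0"
    by simp
  then have "Re (u + 1 + cnj u) = 0"
    by (simp only: zero_complex.simps)
  then have "2 * Re u + 1 = 0"
    by simp
  then show ?thesis
    unfolding u_def by linarith
qed

lemma polar: "z = of_real (cmod z) * sgn (z::complex)"
  by (cases "z = 0") (simp_all add: sgn_div_norm scaleR_conv_of_real)

lemma triod_iff: "z \<in> triod \<longleftrightarrow> z = 0 \<or> sgn z \<in> dirs \<and> cmod z \<le> 1"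
proof (cases "z = 0")
  case True
  then show ?thesis by (auto simp: triod_def intro!: image_eqI[of _ _ 0])
next
  case False
  have z3: "z ^ 3 = of_real (cmod z ^ 3) * sgn z ^ 3"
    by (subst polar) (simp add: power_mult_distrib)
  show ?thesis
  proof
    assume "z \<in> triod"
    then obtain t where t: "z ^ 3 = of_real t" "0 \<le> t" "t \<le> 1"
      by (auto simp: triod_def)
    then have "cmod z ^ 3 = t"
      by (metis norm_of_real norm_power abs_of_nonneg)
    then show "z = 0 \<or> sgn z \<in> dirs \<and> cmod z \<le> 1"
      using t z3 False by (auto simp: dirs_def power_le_one_iff)
  next
    assume "z = 0 \<or> sgn z \<in> dirs \<and> cmod z \<le> 1"
    then have "z ^ 3 = of_real (cmod z ^ 3)" "cmod z ^ 3 \<in> {0..1}"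
      using False z3 by (auto simp: dirs_def power_le_one)
    then show "z \<in> triod" unfolding triod_def by blast
  qed
qed

lemma zero_in_triod: "0 \<in> triod"
  by (simp add: triod_iff)

lemma sgn_in_dirs: "z \<in> triod \<Longrightarrow> z \<noteq> 0 \<Longrightarrow> sgn z \<in> dirs"
  by (simp add: triod_iff)

lemma Re_mult_cnj:
  assumes "z \<in> triod" "w \<in> dirs"
  shows "Re (z * cnj w) = (if sgn z = w then cmod z else - (cmod z / 2))"
proof (cases "z = 0")
  case False
  have "z * cnj w = of_real (cmod z) * (sgn z * cnj w)"
    using polar[of z] by (metis mult.assoc)
  then have "Re (z * cnj w) = cmod z * Re (sgn z * cnj w)"
    by (metis Re_complex_of_real Im_complex_of_real times_complex.simps(1) mult_zero_left diff_0_right)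
  moreover have "Re (sgn z * cnj w) = (if sgn z = w then 1 else - 1 / 2)"
    using Re_dirs_mult_cnj[OF assms(2) sgn_in_dirs[OF assms(1) False]] dirs_mult_cnj[OF assms(2)]
    by (metis one_complex.simps(1))
  ultimately show ?thesis
    by (metis mult.right_neutral times_divide_eq_right mult_minus_right minus_divide_left)
qed (use dirs_nonzero[OF assms(2)] in simp)

lemma coord_eq:
  assumes "z \<in> triod" "w \<in> dirs"
  shows "coord w z = (if sgn z = w then cmod z else 0)"
  unfolding coord_def Re_mult_cnj[OF assms] by auto

lemma coord_zero [simp]: "coord w 0 = 0"
  by (simp add: coord_def)

lemma coord_nonneg: "0 \<le> coord w z"
  by (simp add: coord_def)

lemma coord_sgn: "z \<in> triod \<Longrightarrow> z \<noteq> 0 \<Longrightarrow> coord (sgn z) z = cmod z"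
  by (simp add: coord_eq sgn_in_dirs)

lemma continuous_on_coord: "continuous_on S (coord w)"
  unfolding coord_def by (intro continuous_intros)

lemma polar_eqI: "sgn x = sgn y \<Longrightarrow> cmod x = cmod y \<Longrightarrow> x = (y::complex)"
  by (metis polar)

lemma coord_pos_imp:
  assumes "z \<in> triod" "w \<in> dirs" "coord w z > 0"
  shows "sgn z = w" "cmod z = coord w z"
  using assms coord_eq[OF assms(1,2)] by (auto split: if_splits)

lemma coord_eqI:
  assumes "x \<in> triod" "y \<in> triod" "\<And>w. w \<in> dirs \<Longrightarrow> coord w x = coord w y"
  shows "x = y"
proof (cases "x = 0 \<and> y = 0")
  case False
  then consider "x \<noteq> 0" | "y \<noteq> 0" by blast
  then show ?thesis
  proof cases
    case 1
    then have c: "coord (sgn x) y = cmod x" "coord (sgn x) y > 0"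
      using assms(3)[of "sgn x"] coord_sgn[OF assms(1) 1] sgn_in_dirs[OF assms(1) 1] 1
      by (metis, metis zero_less_norm_iff)
    show ?thesis
      using coord_pos_imp[OF assms(2) sgn_in_dirs[OF assms(1) 1] c(2)] c(1) by (metis polar_eqI)
  next
    case 2
    then have c: "coord (sgn y) x = cmod y" "coord (sgn y) x > 0"
      using assms(3)[of "sgn y"] coord_sgn[OF assms(2) 2] sgn_in_dirs[OF assms(2) 2] 2
      by (metis, metis zero_less_norm_iff)
    show ?thesis
      using coord_pos_imp[OF assms(1) sgn_in_dirs[OF assms(2) 2] c(2)] c(1) by (metis polar_eqI)
  qed
qed auto

section \<open>Arcs, branches and convex hulls\<close>

text \<open>
  Betweenness in every coordinate treats arcs inside a branch and arcs through \<open>0\<close> alike, and it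
  is the case of equality in the triangle inequality for \<open>tdist\<close> (\<open>arc_iff_tdist\<close>).
\<close>

definition triod_arc :: "complex \<Rightarrow> complex \<Rightarrow> complex set" where
  "triod_arc x y = {z \<in> triod. \<forall>w\<in>dirs. min (coord w x) (coord w y) \<le> coord w z \<and>
                                  coord w z \<le> max (coord w x) (coord w y)}"

lemma connected_between:
  fixes g :: "complex \<Rightarrow> real"
  assumes "connected K" "continuous_on K g" "x \<in> K" "y \<in> K"
    and "min (g x) (g y) \<le> t" "t \<le> max (g x) (g y)"
  shows "\<exists>k\<in>K. g k = t"
proof -
  have "connected (g ` K)"
    using assms(1,2) by (rule connected_continuous_image[rotated])
  then have "t \<in> g ` K"
    using assms(3-6) unfolding connected_iff_interval
    by (metis imageI max_def min_def)
  then show ?thesis by auto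
qed

text \<open>
  The triod is uniquely arcwise connected. By the intermediate value theorem, a nonzero point of
  the arc is reached through the coordinate of its own branch, and \<open>0\<close> through
  \<open>Re (z * cnj (sgn x))\<close>, which vanishes nowhere else on the triod.
\<close>

lemma arc_subset_connected:
  assumes K: "connected K" "K \<subseteq> triod" and xy: "x \<in> K" "y \<in> K"
  shows "triod_arc x y \<subseteq> K"
proof
  fix z assume z: "z \<in> triod_arc x y"
  then have zt: "z \<in> triod" by (simp add: triod_arc_def)
  show "z \<in> K"
  proof (cases "z = 0")
    case False
    then have w: "sgn z \<in> dirs" by (rule sgn_in_dirs[OF zt])
    have "min (coord (sgn z) x) (coord (sgn z) y) \<le> coord (sgn z) z \<and>
        coord (sgn z) z \<le> max (coord (sgn z) x) (coord (sgn z) y)"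
      using z w by (simp add: triod_arc_def)
    then obtain k where k: "k \<in> K" "coord (sgn z) k = coord (sgn z) z"
      using connected_between[OF K(1) continuous_on_coord xy] by blast
    then have c: "coord (sgn z) k = cmod z" "coord (sgn z) k > 0"
      using coord_sgn[OF zt False] False by simp_all
    have kt: "k \<in> triod" using K(2) k(1) by blast
    have "k = z"
      by (rule polar_eqI[OF coord_pos_imp(1)[OF kt w c(2)]]) (use coord_pos_imp(2)[OF kt w c(2)] c(1) in simp)
    then show ?thesis using k by simp
  next
    case True
    show ?thesis
    proof (cases "x = 0")
      case False
      have xt: "x \<in> triod" "y \<in> triod" using xy K by auto
      let ?w = "sgn x"
      have w: "?w \<in> dirs" using sgn_in_dirs[OF xt(1) False] .
      have "min (coord ?w x) (coord ?w y) \<le> 0"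
        using z w True by (auto simp: triod_arc_def)
      then have "coord ?w y = 0"
        using coord_sgn[OF xt(1) False] False coord_nonneg[of ?w y] by (auto simp: min_def split: if_splits)
      then have "Re (y * cnj ?w) \<le> 0"
        by (simp add: coord_def)
      moreover have "Re (x * cnj ?w) > 0"
        using Re_mult_cnj[OF xt(1) w] False by simp
      moreover have cont: "continuous_on K (\<lambda>z. Re (z * cnj ?w))"
        by (intro continuous_intros)
      ultimately obtain k where k: "k \<in> K" "Re (k * cnj ?w) = 0"
        using connected_between[OF K(1) cont xy, of 0]
        by (metis less_imp_le max.coboundedI1 min.coboundedI2)
      then have "k = 0"
        using Re_mult_cnj[of k ?w] w K(2) by (metis divide_eq_0_iff neg_equal_0_iff_equal norm_eq_zero subsetD zero_neq_numeral)
      then show ?thesis using k True by simp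
    qed (use True xy in auto)
  qed
qed

lemma arc_commute: "triod_arc x y = triod_arc y x"
  by (auto simp: triod_arc_def min.commute max.commute)

lemma left_in_arc: "x \<in> triod \<Longrightarrow> x \<in> triod_arc x y" and right_in_arc: "y \<in> triod \<Longrightarrow> y \<in> triod_arc x y"
  by (auto simp: triod_arc_def)

lemma arc_subset_triod: "triod_arc x y \<subseteq> triod"
  by (auto simp: triod_arc_def)

lemma radial_subset_triod:
  assumes "v \<in> triod" "z \<in> closed_segment 0 v"
  shows "z \<in> triod" "z \<noteq> 0 \<Longrightarrow> sgn z = sgn v" "cmod z \<le> cmod v"
proof -
  obtain t where t: "0 \<le> t" "t \<le> 1" "z = t *\<^sub>R v"
    using assms(2) by (auto simp: in_segment)
  show s: "z \<noteq> 0 \<Longrightarrow> sgn z = sgn v"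
    using t by (auto simp: sgn_scaleR)
  show n: "cmod z \<le> cmod v"
    using t by (auto simp: mult_left_le_one_le)
  show "z \<in> triod"
    using s n assms(1) unfolding triod_iff by (metis norm_zero norm_le_zero_iff order_trans)
qed

lemma in_radial_iff:
  assumes "v \<in> triod" "z \<in> triod"
  shows "z \<in> closed_segment 0 v \<longleftrightarrow> z = 0 \<or> sgn z = sgn v \<and> cmod z \<le> cmod v"
proof
  assume "z = 0 \<or> sgn z = sgn v \<and> cmod z \<le> cmod v"
  then show "z \<in> closed_segment 0 v"
  proof
    assume a: "sgn z = sgn v \<and> cmod z \<le> cmod v"
    show ?thesis
    proof (cases "v = 0")
      case False
      have "z = (cmod z / cmod v) *\<^sub>R v"
        using polar[of z] polar[of v] a False
        by (metis (no_types, opaque_lifting) nonzero_eq_divide_eq norm_eq_zero of_real_divide of_real_eq_0_iff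
            scaleR_conv_of_real mult.assoc times_divide_eq_left)
      then show ?thesis
        using a False unfolding in_segment by (intro exI[of _ "cmod z / cmod v"]) auto
    qed (use a in auto)
  qed auto
qed (use radial_subset_triod[OF assms(1)] in auto)

text \<open>
  Coordinates are monotone along a ray, so the segment lies in the arc; conversely, the segment is
  connected.
\<close>

lemma segment_eq_arc:
  assumes v: "v \<in> triod" and u: "u \<in> closed_segment 0 v"
  shows "closed_segment u v = triod_arc u v"
proof
  have ut: "u \<in> triod" using radial_subset_triod[OF v u] by simp
  have "closed_segment u v \<subseteq> closed_segment 0 v"
    using u by (simp add: subset_closed_segment)
  then have sub: "closed_segment u v \<subseteq> triod"
    using radial_subset_triod(1)[OF v] by blast
  then show "triod_arc u v \<subseteq> closed_segment u v"
    by (intro arc_subset_connected) auto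
  show "closed_segment u v \<subseteq> triod_arc u v"
  proof
    fix z assume z: "z \<in> closed_segment u v"
    have "min (coord w u) (coord w v) \<le> coord w z \<and> coord w z \<le> max (coord w u) (coord w v)"
      if w: "w \<in> dirs" for w
    proof -
      obtain s where s: "0 \<le> s" "s \<le> 1" "u = s *\<^sub>R v"
        using u by (auto simp: in_segment)
      obtain t where t: "0 \<le> t" "t \<le> 1" "z = (1 - t) *\<^sub>R u + t *\<^sub>R v"
        using z by (auto simp: in_segment)
      have zc: "z = ((1 - t) * s + t) *\<^sub>R v"
        using s t by (simp add: algebra_simps)
      have pos: "coord w (r *\<^sub>R v) = r * coord w v" if "0 \<le> r" for r
      proof -
        have "Re (r *\<^sub>R v * cnj w) = r * Re (v * cnj w)"
          by (simp only: mult_scaleR_left scaleR_complex.simps)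
        then show ?thesis
          using that by (cases "0 \<le> Re (v * cnj w)") (simp_all add: coord_def max_def mult_nonneg_nonpos mult_le_0_iff zero_le_mult_iff)
      qed
      have "s * coord w v \<le> ((1 - t) * s + t) * coord w v" "((1 - t) * s + t) * coord w v \<le> 1 * coord w v"
      proof -
        have "0 \<le> t * (1 - s)" "0 \<le> (1-t) * (1 - s)" using s t by auto
        then have "s \<le> (1 - t) * s + t" "(1 - t) * s + t \<le> 1" by (auto simp: algebra_simps)
        then show "s * coord w v \<le> ((1 - t) * s + t) * coord w v" "((1 - t) * s + t) * coord w v \<le> 1 * coord w v"
          using coord_nonneg by (intro mult_right_mono; simp)+
      qed
      then show ?thesis
        using s t pos[of s] pos[of "(1 - t) * s + t"] zc by (auto simp: min_le_iff_disj le_max_iff_disj)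
    qed
    then show "z \<in> triod_arc u v"
      using z sub by (auto simp: triod_arc_def)
  qed
qed

text \<open>
  A connected set that avoids \<open>0\<close> cannot contain two directions, because some coordinate has to be
  positive on the whole arc between any two of its points.
\<close>

lemma branch_of:
  assumes x: "x \<in> triod - {0}"
  shows "connected_component_set (triod - {0}) x = {z \<in> triod - {0}. sgn z = sgn x}"
proof
  show "connected_component_set (triod - {0}) x \<subseteq> {z \<in> triod - {0}. sgn z = sgn x}"
  proof
    fix z assume "z \<in> connected_component_set (triod - {0}) x"
    then obtain K where K: "connected K" "K \<subseteq> triod - {0}" "x \<in> K" "z \<in> K"
      by (auto simp: connected_component_def)
    then have "0 \<notin> triod_arc x z"
      using arc_subset_connected[of K x z] by blast
    then obtain w where w: "w \<in> dirs" "min (coord w x) (coord w z) > 0"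
      using zero_in_triod unfolding triod_arc_def
      by (force simp: coord_nonneg le_max_iff_disj)
    then have "sgn x = w" "sgn z = w"
      using coord_pos_imp[of _ w] K by auto
    then show "z \<in> {z \<in> triod - {0}. sgn z = sgn x}" using K by auto
  qed
  show "{z \<in> triod - {0}. sgn z = sgn x} \<subseteq> connected_component_set (triod - {0}) x"
  proof
    fix z assume z: "z \<in> {z \<in> triod - {0}. sgn z = sgn x}"
    have *: "closed_segment p q \<subseteq> triod - {0}"
      if "p \<in> triod - {0}" "q \<in> triod - {0}" "sgn p = sgn q" "cmod p \<le> cmod q" for p q
    proof -
      have p: "p \<in> closed_segment 0 q"
        using in_radial_iff[of q p] that by auto
      have "closed_segment p q = triod_arc p q" by (rule segment_eq_arc) (use that p in auto)
      moreover have "0 \<notin> triod_arc p q"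
        using coord_sgn[of p] coord_sgn[of q] that sgn_in_dirs[of p]
        by (auto simp: triod_arc_def min_le_iff_disj intro!: bexI[of _ "sgn p"])
      ultimately show ?thesis using arc_subset_triod by blast
    qed
    have "closed_segment x z \<subseteq> triod - {0}"
      using *[of x z] *[of z x] x z by (cases "cmod x \<le> cmod z") (auto simp: closed_segment_commute)
    then show "z \<in> connected_component_set (triod - {0}) x"
      by (auto simp: connected_component_def intro!: exI[of _ "closed_segment x z"])
  qed
qed

lemma same_branch_iff:
  assumes "x \<in> triod" "y \<in> triod"
  shows "(\<exists>B\<in>branches. x \<in> B \<and> y \<in> B) \<longleftrightarrow> x \<noteq> 0 \<and> sgn x = sgn y"
proof
  assume "\<exists>B\<in>branches. x \<in> B \<and> y \<in> B"
  then obtain p where "p \<in> triod - {0}" "x \<in> connected_component_set (triod - {0}) p"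
      "y \<in> connected_component_set (triod - {0}) p"
    by (auto simp: branches_def components_def)
  then show "x \<noteq> 0 \<and> sgn x = sgn y"
    unfolding branch_of[OF \<open>p \<in> triod - {0}\<close>] by (metis (mono_tags, lifting) DiffD2 insertI1 mem_Collect_eq)
next
  assume a: "x \<noteq> 0 \<and> sgn x = sgn y"
  then have "y \<noteq> 0" by (metis sgn_zero_iff)
  then have "x \<in> connected_component_set (triod - {0}) x" "y \<in> connected_component_set (triod - {0}) x"
    using branch_of[of x] a assms by auto
  moreover have "connected_component_set (triod - {0}) x \<in> branches"
    using a assms by (auto simp: branches_def components_def)
  ultimately show "\<exists>B\<in>branches. x \<in> B \<and> y \<in> B"
    by (intro bexI[of _ "connected_component_set (triod - {0}) x"] conjI)
qed

text \<open>
  As an \<open>l\<^sup>1\<close> distance in the coordinates, \<open>tdist\<close> becomes accessible to real arithmetic.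
\<close>

lemma tdist_sum:
  assumes "x \<in> triod" "y \<in> triod"
  shows "tdist x y = (\<Sum>w\<in>dirs. \<bar>coord w x - coord w y\<bar>)"
proof (cases "x \<noteq> 0 \<and> sgn x = sgn y")
  case True
  have "(\<Sum>w\<in>dirs. \<bar>coord w x - coord w y\<bar>) = (\<Sum>w\<in>dirs. if w = sgn x then \<bar>cmod x - cmod y\<bar> else 0)"
    by (intro sum.cong) (use coord_eq assms True in auto)
  also have "\<dots> = \<bar>cmod x - cmod y\<bar>"
    using sgn_in_dirs[of x] assms True by (simp add: finite_dirs sum.delta)
  also have "\<dots> = cmod (x - y)"
  proof -
    have "x - y = of_real (cmod x - cmod y) * sgn x"
      using polar[of x] polar[of y] True by (metis left_diff_distrib of_real_diff)
    then show ?thesis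
      using True by (metis norm_mult norm_of_real norm_sgn mult_1_right)
  qed
  finally show ?thesis
    using True same_branch_iff[OF assms] by (simp add: tdist_def)
next
  case False
  have *: "(\<Sum>w\<in>dirs. coord w z) = cmod z" if "z \<in> triod" for z
  proof -
    have "(\<Sum>w\<in>dirs. coord w z) = (\<Sum>w\<in>dirs. if w = sgn z then cmod z else 0)"
      by (intro sum.cong) (use coord_eq that in auto)
    then show ?thesis
      using sgn_in_dirs[of z] that by (cases "z = 0") (simp_all add: finite_dirs sum.delta)
  qed
  have "(\<Sum>w\<in>dirs. \<bar>coord w x - coord w y\<bar>) = (\<Sum>w\<in>dirs. coord w x + coord w y)"
    by (intro sum.cong) (use coord_eq assms False in auto)
  then show ?thesis
    unfolding tdist_def same_branch_iff[OF assms] using False *[OF assms(1)] *[OF assms(2)]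
    by (simp only: sum.distrib if_False)
qed

lemma arc_iff_tdist:
  assumes "x \<in> triod" "y \<in> triod" "z \<in> triod"
  shows "z \<in> triod_arc x y \<longleftrightarrow> tdist x z + tdist z y = tdist x y"
proof -
  let ?g = "\<lambda>w. \<bar>coord w x - coord w z\<bar> + \<bar>coord w z - coord w y\<bar> - \<bar>coord w x - coord w y\<bar>"
  have "tdist x z + tdist z y = tdist x y \<longleftrightarrow> (\<Sum>w\<in>dirs. ?g w) = 0"
    using assms by (simp add: tdist_sum sum.distrib sum_subtractf)
  also have "\<dots> \<longleftrightarrow> (\<forall>w\<in>dirs. ?g w = 0)"
    by (intro sum_nonneg_eq_0_iff finite_dirs) auto
  also have "\<dots> \<longleftrightarrow> z \<in> triod_arc x y"
  proof -
    have "?g w = 0 \<longleftrightarrow> min (coord w x) (coord w y) \<le> coord w z \<and> coord w z \<le> max (coord w x) (coord w y)" for w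
      by linarith
    then show ?thesis using assms by (simp add: triod_arc_def)
  qed
  finally show ?thesis by simp
qed

lemma tdist_pos_iff: "x \<in> triod \<Longrightarrow> y \<in> triod \<Longrightarrow> tdist x y = 0 \<longleftrightarrow> x = y"
  using coord_eqI[of x y] by (auto simp: tdist_sum sum_nonneg_eq_0_iff[OF finite_dirs])

lemma tdist_nonneg: "0 \<le> tdist x y"
  by (simp add: tdist_def)

lemma tdist_commute: "tdist x y = tdist y x"
  by (auto simp: tdist_def norm_minus_commute)

lemma arc_subset_triod_hull: "x \<in> S \<Longrightarrow> y \<in> S \<Longrightarrow> triod_arc x y \<subseteq> triod_hull S"
  unfolding triod_hull_def using arc_subset_connected by blast

lemma subset_triod_hull: "S \<subseteq> triod_hull S"
  by (auto simp: triod_hull_def)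

lemma triod_hull_subset: "K \<subseteq> triod \<Longrightarrow> closed K \<Longrightarrow> connected K \<Longrightarrow> S \<subseteq> K \<Longrightarrow> triod_hull S \<subseteq> K"
  by (auto simp: triod_hull_def)

lemma tdist_le_arc:
  assumes "s \<in> triod" "t \<in> triod" "x \<in> triod_arc s t" "y \<in> triod_arc s t"
  shows "tdist x y \<le> tdist s t"
proof -
  have xy: "x \<in> triod" "y \<in> triod" using assms arc_subset_triod by auto
  have "\<bar>coord w x - coord w y\<bar> \<le> \<bar>coord w s - coord w t\<bar>" if "w \<in> dirs" for w
  proof -
    have "min (coord w s) (coord w t) \<le> coord w x" "coord w x \<le> max (coord w s) (coord w t)"
      "min (coord w s) (coord w t) \<le> coord w y" "coord w y \<le> max (coord w s) (coord w t)"
      using assms(3,4) that by (auto simp: triod_arc_def)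
    then show ?thesis by linarith
  qed
  then show ?thesis
    using assms xy by (simp add: tdist_sum sum_mono)
qed

lemma in_subsegment_iff:
  assumes v: "v \<in> triod" and u: "u \<in> closed_segment 0 v"
  shows "z \<in> closed_segment u v \<longleftrightarrow> z \<in> closed_segment 0 v \<and> cmod u \<le> cmod z"
proof (cases "v = 0")
  case False
  have vd: "sgn v \<in> dirs" using sgn_in_dirs[OF v False] .
  have ut: "u \<in> triod" using radial_subset_triod[OF v u] by simp
  have "z \<in> triod_arc u v \<longleftrightarrow> z \<in> closed_segment 0 v \<and> cmod u \<le> cmod z" if zt: "z \<in> triod"
  proof -
    have cv: "coord w v = (if w = sgn v then cmod v else 0)" if "w \<in> dirs" for w
      using coord_eq[OF v that] by auto
    have cu: "coord w u = (if w = sgn v then cmod u else 0)" if "w \<in> dirs" for w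
      using coord_eq[OF ut that] radial_subset_triod(2)[OF v u] by (cases "u = 0") auto
    have le: "cmod u \<le> cmod v" using radial_subset_triod[OF v u] by simp
    have "z \<in> triod_arc u v \<longleftrightarrow> (\<forall>w\<in>dirs. if w = sgn v then cmod u \<le> coord w z \<and> coord w z \<le> cmod v else coord w z = 0)"
      using zt le cv cu coord_nonneg unfolding triod_arc_def by (auto simp: order_antisym)
    also have "\<dots> \<longleftrightarrow> (z = 0 \<or> sgn z = sgn v \<and> cmod z \<le> cmod v) \<and> cmod u \<le> cmod z"
    proof (cases "z = 0")
      case True
      then show ?thesis using vd by auto
    next
      case z: False
      then have zd: "sgn z \<in> dirs" "cmod z > 0" using sgn_in_dirs[OF zt] by auto
      show ?thesis using coord_eq[OF zt] vd zd z by (auto split: if_splits)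
    qed
    finally show ?thesis using in_radial_iff[OF v zt] by simp
  qed
  moreover have "closed_segment u v \<subseteq> triod"
    using segment_eq_arc[OF v u] arc_subset_triod by simp
  ultimately show ?thesis
    using segment_eq_arc[OF v u] radial_subset_triod(1)[OF v, of z] by blast
qed (use u in auto)

lemma zero_in_arc:
  assumes "x \<in> triod" "y \<in> triod" "sgn x \<noteq> sgn y"
  shows "0 \<in> triod_arc x y"
  unfolding triod_arc_def using coord_eq[OF assms(1)] coord_eq[OF assms(2)] assms(3) zero_in_triod
  by (auto simp: min_le_iff_disj le_max_iff_disj coord_nonneg)

lemma continuous_on_tdist:
  assumes "continuous_on S g" "continuous_on S h" "g ` S \<subseteq> triod" "h ` S \<subseteq> triod"
  shows "continuous_on S (\<lambda>y. tdist (g y) (h y))"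
proof -
  have "continuous_on S (\<lambda>y. \<Sum>w\<in>dirs. \<bar>coord w (g y) - coord w (h y)\<bar>)"
    unfolding coord_def by (intro continuous_intros assms)
  then show ?thesis
    by (rule continuous_on_eq) (use assms in \<open>auto intro!: tdist_sum[symmetric]\<close>)
qed

lemma ex_max_norm:
  fixes A :: "complex set"
  assumes "finite A" "A \<noteq> {}"
  shows "\<exists>u\<in>A. \<forall>p\<in>A. cmod p \<le> cmod u"
proof -
  have "Max (cmod ` A) \<in> cmod ` A"
    using assms by simp
  then obtain u where "Max (cmod ` A) = cmod u" "u \<in> A"
    by (rule imageE)
  moreover have "cmod p \<le> Max (cmod ` A)" if "p \<in> A" for p
    using assms that by simp
  ultimately show ?thesis by auto
qed

lemma ex_min_norm:
  fixes A :: "complex set"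
  assumes "finite A" "A \<noteq> {}"
  shows "\<exists>u\<in>A. \<forall>p\<in>A. cmod u \<le> cmod p"
proof -
  have "Min (cmod ` A) \<in> cmod ` A"
    using assms by simp
  then obtain u where "Min (cmod ` A) = cmod u" "u \<in> A"
    by (rule imageE)
  moreover have "Min (cmod ` A) \<le> cmod p" if "p \<in> A" for p
    using assms that by simp
  ultimately show ?thesis by auto
qed

lemma sgn_eq_if_zero_notin_hull:
  assumes "S \<subseteq> triod" "0 \<notin> triod_hull S" "x \<in> S" "y \<in> S"
  shows "sgn x = sgn y"
  using zero_in_arc[of x y] arc_subset_triod_hull[OF assms(3,4)] assms by blast

lemma triod_hull_one_branch:
  assumes fin: "finite S" and ne: "S \<noteq> {}" and sub: "S \<subseteq> triod"
    and sg: "\<And>x y. x \<in> S \<Longrightarrow> y \<in> S \<Longrightarrow> sgn x = sgn y"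
  shows "\<exists>u\<in>S. \<exists>v\<in>S. u \<in> closed_segment 0 v \<and> triod_hull S = closed_segment u v"
proof -
  obtain u where u: "u \<in> S" "\<And>x. x \<in> S \<Longrightarrow> cmod u \<le> cmod x"
    using ex_min_norm[OF fin ne] by blast
  obtain v where v: "v \<in> S" "\<And>x. x \<in> S \<Longrightarrow> cmod x \<le> cmod v"
    using ex_max_norm[OF fin ne] by blast
  have t: "u \<in> triod" "v \<in> triod" using u v sub by auto
  have uv: "u \<in> closed_segment 0 v"
    using in_radial_iff[OF t(2,1)] sg[OF u(1) v(1)] v(2)[OF u(1)] by simp
  have "triod_hull S = closed_segment u v"
  proof
    show "triod_hull S \<subseteq> closed_segment u v"
    proof (rule triod_hull_subset)
      show "closed_segment u v \<subseteq> triod" using segment_eq_arc[OF t(2) uv] arc_subset_triod by simp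
      show "S \<subseteq> closed_segment u v"
        using in_subsegment_iff[OF t(2) uv] in_radial_iff[OF t(2)] sg v u sub by blast
    qed auto
    show "closed_segment u v \<subseteq> triod_hull S"
      using arc_subset_triod_hull[OF u(1) v(1)] segment_eq_arc[OF t(2) uv] by simp
  qed
  then show ?thesis using u v uv by blast
qed

text \<open>
  The connected set need not be closed, so this is not immediate from the definition of the hull;
  it uses that the hull of a finite set inside a branch is an arc between two of its points.
\<close>

lemma triod_hull_subset_connected:
  assumes "finite S" "S \<noteq> {}" "connected K" "K \<subseteq> triod - {0}" "S \<subseteq> K"
  shows "triod_hull S \<subseteq> K"
proof -
  have S: "S \<subseteq> triod" and K: "K \<subseteq> triod" using assms by auto
  have "sgn x = sgn y" if "x \<in> S" "y \<in> S" for x y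
    using zero_in_arc[of x y] arc_subset_connected[OF assms(3) K, of x y] that S assms(4,5) by blast
  then obtain u v where uv: "u \<in> S" "v \<in> S" "u \<in> closed_segment 0 v" "triod_hull S = closed_segment u v"
    using triod_hull_one_branch[OF assms(1,2) S] by blast
  then show ?thesis
    using arc_subset_connected[OF assms(3) K, of u v] segment_eq_arc[of v u] assms(5) S by auto
qed

section \<open>Cycles\<close>

lemma is_cycle_subset: "is_cycle f P \<Longrightarrow> P \<subseteq> triod - {0}"
  by (simp add: is_cycle_def)

lemma is_cycle_nonempty: "is_cycle f P \<Longrightarrow> P \<noteq> {}"
  by (auto simp: is_cycle_def)

lemma is_cycle_finite:
  assumes "is_cycle f P" shows "finite P"
proof -
  obtain x n where x: "n > 0" "(f ^^ n) x = x" "P = range (\<lambda>k. (f ^^ k) x)"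
    using assms by (auto simp: is_cycle_def)
  have "P \<subseteq> (\<lambda>k. (f ^^ k) x) ` {..<n}"
    unfolding x(3) using x(1) funpow_mod_eq[OF x(2)] by (metis (mono_tags, lifting) image_eqI image_subsetI lessThan_iff mod_less_divisor)
  then show ?thesis by (rule finite_subset) simp
qed

lemma is_cycle_period:
  assumes "is_cycle f P"
  shows "\<exists>n>0. \<forall>x\<in>P. (f ^^ n) x = x"
proof -
  obtain x n where x: "n > 0" "(f ^^ n) x = x" "P = range (\<lambda>k. (f ^^ k) x)"
    using assms by (auto simp: is_cycle_def)
  have "(f ^^ n) ((f ^^ k) x) = (f ^^ k) x" for k
    by (metis x(2) funpow_add comp_apply add.commute)
  then show ?thesis using x by blast
qed

lemma is_cycle_closed: "is_cycle f P \<Longrightarrow> x \<in> P \<Longrightarrow> f x \<in> P"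
  by (auto simp: is_cycle_def) (metis funpow.simps(2) comp_apply rangeI)

lemma is_cycle_funpow: "is_cycle f P \<Longrightarrow> x \<in> P \<Longrightarrow> (f ^^ k) x \<in> P"
  by (induction k) (auto intro: is_cycle_closed)

lemma is_cycle_transitive:
  assumes "is_cycle f P" "y \<in> P" "z \<in> P"
  shows "\<exists>k. z = (f ^^ k) y"
proof -
  obtain x n where x: "n > 0" "(f ^^ n) x = x" "P = range (\<lambda>k. (f ^^ k) x)"
    using assms by (auto simp: is_cycle_def)
  obtain j k where jk: "y = (f ^^ j) x" "z = (f ^^ k) x"
    using assms x by blast
  have "(f ^^ (k + (j * n - j))) y = (f ^^ (k + (j * n - j) + j)) x"
    by (simp add: jk funpow_add)
  also have "k + (j * n - j) + j = k + j * n"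
    using x(1) by (cases n) auto
  also have "(f ^^ (k + j * n)) x = z"
    using funpow_mod_eq[OF x(2), of "k + j * n"] funpow_mod_eq[OF x(2), of k] jk by simp
  finally show ?thesis by metis
qed

lemma is_cycle_inj:
  assumes "is_cycle f P" shows "inj_on f P"
proof (rule inj_onI)
  fix a b assume ab: "a \<in> P" "b \<in> P" "f a = f b"
  obtain n where n: "n > 0" "\<forall>x\<in>P. (f ^^ n) x = x"
    using is_cycle_period[OF assms] by blast
  then obtain m where "n = Suc m" by (cases n) auto
  then show "a = b"
    using n ab by (metis funpow_Suc_right comp_apply)
qed

lemma is_cycle_orbit:
  assumes "is_cycle f P" "x \<in> P" "x \<in> X" "f ` X \<subseteq> X"
  shows "P \<subseteq> X"
proof
  fix y assume "y \<in> P"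
  then obtain k where k: "y = (f ^^ k) x"
    using is_cycle_transitive[OF assms(1,2)] by blast
  have "(f ^^ k) x \<in> X" for k
    by (induction k) (use assms in auto)
  then show "y \<in> X" using k by simp
qed

section \<open>Edges of a linear map\<close>

text \<open>
  The last condition places \<open>0\<close> in the interior of the tree; it holds for every cycle of a map
  whose only fixed point is \<open>0\<close> (\<open>cycle_meets_two_branches\<close>).
\<close>

locale linear_cycle =
  fixes f :: "complex \<Rightarrow> complex" and P :: "complex set"
  assumes cyc: "is_cycle f P" and lin: "P_linear P f"
    and spread: "\<exists>x\<in>P. \<exists>y\<in>P. sgn x \<noteq> sgn y"
begin

lemma cont: "continuous_on triod f" and maps: "x \<in> triod \<Longrightarrow> f x \<in> triod" and f0 [simp]: "f 0 = 0"
  using lin by (auto simp: P_linear_def)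

lemma P_triod: "p \<in> P \<Longrightarrow> p \<in> triod" and P_nonzero: "p \<in> P \<Longrightarrow> p \<noteq> 0"
  using is_cycle_subset[OF cyc] by auto

lemma fP: "p \<in> P \<Longrightarrow> f p \<in> P"
  by (rule is_cycle_closed[OF cyc])

abbreviation verts :: "complex set" where "verts \<equiv> insert 0 P"

abbreviation tree :: "complex set" where "tree \<equiv> triod_hull P"

lemma finite_verts: "finite verts" and finite_P: "finite P"
  using is_cycle_finite[OF cyc] by auto

lemma verts_triod: "p \<in> verts \<Longrightarrow> p \<in> triod"
  using P_triod zero_in_triod by auto

lemma f_verts: "p \<in> verts \<Longrightarrow> f p \<in> verts"
  using fP by auto

lemma f_inj_verts: "p \<in> verts \<Longrightarrow> q \<in> verts \<Longrightarrow> f p = f q \<Longrightarrow> p = q"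
  using is_cycle_inj[OF cyc] fP P_nonzero by (auto simp: inj_on_def)

lemma tree_eq: "tree = (\<Union>v\<in>P. closed_segment 0 v)"
proof
  show "tree \<subseteq> (\<Union>v\<in>P. closed_segment 0 v)"
  proof (rule triod_hull_subset)
    show "(\<Union>v\<in>P. closed_segment 0 v) \<subseteq> triod"
      using radial_subset_triod(1)[OF P_triod] by blast
    show "closed (\<Union>v\<in>P. closed_segment 0 v)"
      using finite_P by (intro closed_UN) auto
    show "connected (\<Union>v\<in>P. closed_segment 0 v)"
      by (intro connected_Union) auto
  qed auto
  have "closed_segment 0 v \<subseteq> K" if K: "K \<subseteq> triod" "connected K" "P \<subseteq> K" and v: "v \<in> P" for K v
  proof -
    have "0 \<in> K"
      using spread K zero_in_arc arc_subset_connected[OF K(2,1)] by (metis subsetD)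
    then show ?thesis
      using arc_subset_connected[OF K(2,1), of 0 v] v K segment_eq_arc[of v 0] P_triod[OF v] by auto
  qed
  then show "(\<Union>v\<in>P. closed_segment 0 v) \<subseteq> tree"
    unfolding triod_hull_def by blast
qed

lemma tree_triod: "x \<in> tree \<Longrightarrow> x \<in> triod"
  unfolding tree_eq using radial_subset_triod(1)[OF P_triod] by blast

lemma connected_tree: "connected tree"
  unfolding tree_eq by (intro connected_Union) auto

lemma verts_tree: "p \<in> verts \<Longrightarrow> p \<in> tree"
  using is_cycle_nonempty[OF cyc] unfolding tree_eq by auto

lemma arc_tree: "x \<in> tree \<Longrightarrow> y \<in> tree \<Longrightarrow> triod_arc x y \<subseteq> tree"
  using arc_subset_connected[OF connected_tree] tree_triod by blast

lemma connected_eq_tree: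
  assumes "connected K" "K \<subseteq> tree" "0 \<in> K" "P \<subseteq> K"
  shows "K = tree"
proof
  have "K \<subseteq> triod" using assms(2) tree_triod by blast
  then have "closed_segment 0 v \<subseteq> K" if "v \<in> P" for v
    using arc_subset_connected[OF assms(1), of 0 v] segment_eq_arc[OF P_triod[OF that], of 0] assms that by auto
  then show "tree \<subseteq> K" unfolding tree_eq by blast
qed (use assms in simp)

text \<open>
  Edges are oriented: \<open>u\<close> is the end nearer to \<open>0\<close>, possibly \<open>0\<close> itself, whereas \<open>v\<close> always belongs
  to \<open>P\<close>.
\<close>

definition edge :: "complex \<Rightarrow> complex \<Rightarrow> bool" where
  "edge u v \<longleftrightarrow> u \<in> verts \<and> v \<in> P \<and> u \<noteq> v \<and> u \<in> closed_segment 0 v \<and>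
     closed_segment u v \<inter> verts \<subseteq> {u, v}"

lemma edgeD:
  assumes "edge u v"
  shows "u \<in> verts" "v \<in> P" "u \<noteq> v" "u \<in> closed_segment 0 v" "v \<in> triod" "u \<in> triod"
    "closed_segment u v = triod_arc u v" "closed_segment u v \<subseteq> tree" "cmod u < cmod v"
    "u = 0 \<or> sgn u = sgn v"
proof -
  show *: "u \<in> verts" "v \<in> P" "u \<noteq> v" "u \<in> closed_segment 0 v" "v \<in> triod" "u \<in> triod"
    using assms P_triod verts_triod by (auto simp: edge_def)
  show s: "closed_segment u v = triod_arc u v"
    using segment_eq_arc * by blast
  show "closed_segment u v \<subseteq> tree"
    using arc_tree[of u v] verts_tree * s by auto
  show u0: "u = 0 \<or> sgn u = sgn v"
    using radial_subset_triod[OF *(5,4)] by auto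
  show "cmod u < cmod v"
    using radial_subset_triod(3)[OF *(5,4)] polar_eqI[of u v] u0 *(3) by (cases "u = 0") (auto simp: less_le)
qed

lemma edge_no_vertex:
  assumes "edge u v" "p \<in> verts" "p \<in> closed_segment 0 v" "cmod u < cmod p" "cmod p < cmod v"
  shows False
proof -
  have "p \<in> closed_segment u v"
    using assms edgeD[OF assms(1)] by (subst in_subsegment_iff) auto
  then have "p \<in> {u, v}"
    using assms by (auto simp: edge_def)
  then show False using assms by auto
qed

text \<open>
  The open edge lies in a component of the tree without its vertices, on which distances are
  multiplied by a constant; by continuity this persists at the ends. The constant is eliminated by
  comparing with the whole edge.
\<close>

lemma edge_affine:
  assumes e: "edge u v" and xy: "x \<in> closed_segment u v" "y \<in> closed_segment u v"
  shows "tdist (f x) (f y) * tdist u v = tdist (f u) (f v) * tdist x y"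
proof -
  note E = edgeD[OF e]
  let ?O = "open_segment u v"
  have cl: "closure ?O = closed_segment u v"
    using E(3) by simp
  have "?O \<subseteq> tree - verts"
    using E(8) e by (auto simp: edge_def open_segment_def)
  moreover have "?O \<noteq> {}"
    using E(3) by auto
  ultimately obtain J where J: "J \<in> components (tree - verts)" "?O \<subseteq> J"
    using exists_component_superset[of ?O "tree - verts"] convex_connected[OF convex_open_segment] by blast
  have "P \<union> {0} = verts" by auto
  then obtain c where c: "\<And>x y. x \<in> J \<Longrightarrow> y \<in> J \<Longrightarrow> tdist (f x) (f y) = c * tdist x y"
    using lin J(1) unfolding P_linear_def affine_on_triod_def by metis
  have sub: "closed_segment u v \<subseteq> triod"
    using E(8) tree_triod by blast
  have contS: "continuous_on (closure ?O) f" "f ` closure ?O \<subseteq> triod" "closure ?O \<subseteq> triod"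
    unfolding cl using continuous_on_subset[OF cont sub] sub maps by auto
  have step1: "tdist (f x) (f y) - c * tdist x y = 0" if x: "x \<in> ?O" and y: "y \<in> closed_segment u v" for x y
  proof (rule continuous_constant_on_closure[of ?O "\<lambda>y. tdist (f x) (f y) - c * tdist x y"])
    have xt: "x \<in> triod" using x sub by (auto simp: open_segment_def)
    show "continuous_on (closure ?O) (\<lambda>y. tdist (f x) (f y) - c * tdist x y)"
      using contS xt maps by (intro continuous_intros continuous_on_tdist) auto
  qed (use c J x y cl in auto)
  have step2: "tdist (f x) (f y) - c * tdist x y = 0" if x: "x \<in> closed_segment u v" and y: "y \<in> closed_segment u v" for x y
  proof (rule continuous_constant_on_closure[of ?O "\<lambda>x. tdist (f x) (f y) - c * tdist x y"])
    have yt: "y \<in> triod" using y sub by auto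
    show "continuous_on (closure ?O) (\<lambda>x. tdist (f x) (f y) - c * tdist x y)"
      using contS yt maps by (intro continuous_intros continuous_on_tdist) auto
  qed (use step1 x y cl in auto)
  have "tdist (f x) (f y) = c * tdist x y" "tdist (f u) (f v) = c * tdist u v"
    using step2[OF xy] step2[of u v] by auto
  then show ?thesis by simp
qed

text \<open>
  Constant stretching preserves the case of equality in the triangle inequality.
\<close>

lemma edge_image:
  assumes e: "edge u v" and z: "z \<in> closed_segment u v"
  shows "f z \<in> triod_arc (f u) (f v)"
proof -
  note E = edgeD[OF e]
  have t: "z \<in> triod" "tdist u v \<noteq> 0"
    using E tree_triod z tdist_pos_iff[of u v] by auto
  have "tdist u z + tdist z v = tdist u v"
    using z E(7) arc_iff_tdist[OF E(6,5) t(1)] by simp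
  then have "(tdist (f u) (f z) + tdist (f z) (f v)) * tdist u v = tdist (f u) (f v) * tdist u v"
    using edge_affine[OF e, of u z] edge_affine[OF e, of z v] z by (simp add: distrib_right flip: distrib_left)
  then have "tdist (f u) (f z) + tdist (f z) (f v) = tdist (f u) (f v)"
    using t(2) by simp
  then show ?thesis
    using arc_iff_tdist maps E t by blast
qed

text \<open>
  Take for \<open>v\<close> the first vertex of the branch at or beyond \<open>y\<close>, and for \<open>u\<close> the vertex preceding
  \<open>v\<close>. The assumption says that no vertex lies strictly between \<open>x\<close> and \<open>y\<close>, and therefore \<open>u\<close>
  does not lie above \<open>x\<close>.
\<close>

lemma edge_containing:
  assumes y: "y \<in> tree" "y \<noteq> 0" and x: "x \<in> closed_segment 0 y"
    and nov: "\<And>p. p \<in> verts \<Longrightarrow> p \<in> closed_segment 0 y \<Longrightarrow> cmod x < cmod p \<Longrightarrow> cmod p < cmod y \<Longrightarrow> False"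
  shows "\<exists>u v. edge u v \<and> x \<in> closed_segment u v \<and> y \<in> closed_segment u v"
proof -
  have yt: "y \<in> triod" using y tree_triod by blast
  let ?A = "{p \<in> P. y \<in> closed_segment 0 p}"
  have "finite ?A" "?A \<noteq> {}" using finite_P y(1) by (auto simp: tree_eq)
  then obtain v where v: "v \<in> ?A" "\<And>p. p \<in> ?A \<Longrightarrow> cmod v \<le> cmod p"
    using ex_min_norm[of ?A] by blast
  have vt: "v \<in> triod" "v \<noteq> 0" using v P_triod P_nonzero by auto
  have yv: "sgn y = sgn v" "cmod y \<le> cmod v"
    using radial_subset_triod[OF vt(1), of y] v y by auto
  let ?B = "{p \<in> verts. p \<in> closed_segment 0 v \<and> p \<noteq> v}"
  have "finite ?B" "0 \<in> ?B" using finite_verts vt by auto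
  then obtain u where u: "u \<in> ?B" "\<And>p. p \<in> ?B \<Longrightarrow> cmod p \<le> cmod u"
    using ex_max_norm[of ?B] by blast
  have "closed_segment u v \<inter> verts \<subseteq> {u, v}"
  proof
    fix p assume p: "p \<in> closed_segment u v \<inter> verts"
    then have p': "p \<in> closed_segment 0 v" "cmod u \<le> cmod p"
      using in_subsegment_iff[OF vt(1), of u p] u(1) by auto
    show "p \<in> {u, v}"
    proof (cases "p = v")
      case False
      then have n: "cmod p = cmod u" using u(2)[of p] p p' by auto
      have "p = u"
      proof (cases "p = 0")
        case False
        then have "u \<noteq> 0" using n by auto
        then have "sgn p = sgn u"
          using radial_subset_triod(2)[OF vt(1), of u] radial_subset_triod(2)[OF vt(1), of p] p' u(1) False
          by auto
        then show ?thesis using n by (rule polar_eqI)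
      qed (use n in auto)
      then show ?thesis by simp
    qed simp
  qed
  then have e: "edge u v" using u v by (auto simp: edge_def)
  note E = edgeD[OF e]
  have xt: "x \<in> triod" "cmod x \<le> cmod y" using radial_subset_triod[OF yt x] by auto
  have x0: "x \<in> closed_segment 0 v"
    using in_radial_iff[OF vt(1) xt(1)] radial_subset_triod[OF yt x] yv by auto
  have "cmod u \<le> cmod x"
  proof (rule ccontr)
    assume a: "\<not> cmod u \<le> cmod x"
    then have u0: "u \<noteq> 0" by auto
    then have uP: "u \<in> P" "sgn u = sgn v" using E by auto
    have "u \<notin> ?A" using v(2)[of u] E(9) by auto
    then have "cmod u < cmod y"
      using uP in_radial_iff[OF E(6) yt] yv by auto
    then have "u \<in> closed_segment 0 y"
      using in_radial_iff[OF yt E(6)] uP yv by auto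
    then show False using nov[of u] a \<open>cmod u < cmod y\<close> uP by auto
  qed
  then have "x \<in> closed_segment u v \<and> y \<in> closed_segment u v"
    using in_subsegment_iff[OF vt(1) E(4)] x0 xt v(1) by auto
  then show ?thesis using e by blast
qed

lemma edge_through:
  assumes "z \<in> tree" "z \<noteq> 0"
  shows "\<exists>u v. edge u v \<and> z \<in> closed_segment u v"
  using edge_containing[OF assms, of z] by auto

definition unseparated :: "complex \<Rightarrow> complex \<Rightarrow> bool" where
  "unseparated x y \<longleftrightarrow> triod_arc x y \<inter> verts \<subseteq> {x, y}"

lemma unseparated_commute: "unseparated x y \<longleftrightarrow> unseparated y x"
  by (auto simp: unseparated_def arc_commute)

lemma unseparated_imp_edge:
  assumes "x \<in> tree" "y \<in> tree" "x \<noteq> y" "unseparated x y"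
  shows "\<exists>u v. edge u v \<and> x \<in> closed_segment u v \<and> y \<in> closed_segment u v"
proof -
  have *: "\<exists>u v. edge u v \<and> x \<in> closed_segment u v \<and> y \<in> closed_segment u v"
    if a: "x \<in> tree" "y \<in> tree" "x \<noteq> y" "unseparated x y" "cmod x \<le> cmod y" for x y
  proof -
    have t: "x \<in> triod" "y \<in> triod" using a tree_triod by auto
    have y0: "y \<noteq> 0" using a by auto
    have "sgn x = sgn y \<or> x = 0"
      using zero_in_arc[OF t] a(4) y0 by (auto simp: unseparated_def)
    then have x: "x \<in> closed_segment 0 y"
      using in_radial_iff[OF t(2,1)] a(5) by auto
    show ?thesis
    proof (rule edge_containing[OF a(2) y0 x])
      fix p assume p: "p \<in> verts" "p \<in> closed_segment 0 y" "cmod x < cmod p" "cmod p < cmod y"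
      then have "p \<in> triod_arc x y"
        using segment_eq_arc[OF t(2) x] in_subsegment_iff[OF t(2) x] by auto
      then show False using a(4) p by (auto simp: unseparated_def)
    qed
  qed
  show ?thesis
    using *[OF assms] *[OF assms(2,1)] assms unseparated_commute by (cases "cmod x \<le> cmod y") auto
qed

lemma f_tree: "x \<in> tree \<Longrightarrow> f x \<in> tree"
proof (cases "x = 0")
  case True
  then show ?thesis using verts_tree by simp
next
  case False
  assume "x \<in> tree"
  then obtain u v where e: "edge u v" "x \<in> closed_segment u v"
    using edge_through False by blast
  then have "f x \<in> triod_arc (f u) (f v)" by (rule edge_image)
  then show ?thesis
    using arc_tree[of "f u" "f v"] verts_tree f_verts edgeD[OF e(1)] by blast
qed

lemma funpow_tree: "x \<in> tree \<Longrightarrow> (f ^^ n) x \<in> tree"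
  by (induction n) (auto intro: f_tree)

lemma continuous_funpow: "continuous_on tree (f ^^ n)"
proof (induction n)
  case (Suc n)
  have "continuous_on ((f ^^ n) ` tree) f"
    using continuous_on_subset[OF cont] funpow_tree tree_triod by blast
  then show ?case using continuous_on_compose[OF Suc] by simp
qed auto

lemma connected_funpow: "connected K \<Longrightarrow> K \<subseteq> tree \<Longrightarrow> connected ((f ^^ n) ` K)"
  by (meson connected_continuous_image continuous_on_subset continuous_funpow)

section \<open>Block structures\<close>

text \<open>
  Such a hull is a segment whose vertices all belong to \<open>S\<close>; so it is a union of edges with both
  ends in \<open>S\<close>, and the image of each of them is an arc between two points of \<open>f ` S\<close>.
\<close>

lemma block_hull_image:
  assumes S: "S \<subseteq> P" "S \<noteq> {}" "0 \<notin> triod_hull S" "P \<inter> triod_hull S \<subseteq> S"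
  shows "f ` triod_hull S \<subseteq> triod_hull (f ` S)"
proof
  fix z' assume "z' \<in> f ` triod_hull S"
  then obtain z where z: "z \<in> triod_hull S" "z' = f z" by blast
  have St: "S \<subseteq> triod" using S(1) P_triod by auto
  obtain u v where uv: "u \<in> S" "v \<in> S" "u \<in> closed_segment 0 v" "triod_hull S = closed_segment u v"
    using triod_hull_one_branch[OF finite_subset[OF S(1) finite_P] S(2) St sgn_eq_if_zero_notin_hull[OF St S(3)]] by blast
  have P: "u \<in> P" "v \<in> P" and t: "u \<in> triod" "v \<in> triod" and nz: "u \<noteq> 0" "v \<noteq> 0"
    using uv S(1) St P_nonzero by auto
  show "z' \<in> triod_hull (f ` S)"
  proof (cases "z \<in> S")
    case True
    then show ?thesis using z subset_triod_hull by blast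
  next
    case False
    then have zP: "z \<notin> P" "z \<noteq> 0" using S z by auto
    have zv: "z \<in> closed_segment 0 v" "cmod u \<le> cmod z"
      using in_subsegment_iff[OF t(2) uv(3)] z uv(4) by auto
    have zt: "z \<in> triod" "sgn z = sgn v" "cmod z \<le> cmod v"
      using radial_subset_triod[OF t(2) zv(1)] zP by auto
    have "z \<in> tree" using zv P unfolding tree_eq by blast
    then obtain a b where e: "edge a b" and zab: "z \<in> closed_segment a b"
      using edge_through zP by blast
    note E = edgeD[OF e]
    have zb: "z \<in> closed_segment 0 b" "cmod a \<le> cmod z"
      using in_subsegment_iff[OF E(5,4)] zab by auto
    have bs: "sgn z = sgn b" "cmod z \<le> cmod b"
      using radial_subset_triod[OF E(5) zb(1)] zP by auto
    have zne: "cmod z \<noteq> cmod b" using bs polar_eqI[of z b] zP E by auto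
    have us: "sgn u = sgn v" using radial_subset_triod[OF t(2) uv(3)] nz by auto
    have ua: "cmod u \<le> cmod a"
    proof (rule ccontr)
      assume "\<not> cmod u \<le> cmod a"
      moreover have "u \<in> closed_segment 0 b"
        using in_radial_iff[OF E(5) t(1)] us bs zv zt by auto
      ultimately show False
        using edge_no_vertex[OF e, of u] P zv bs zne by auto
    qed
    then have a0: "a \<noteq> 0" using nz by auto
    have aP: "a \<in> P" "sgn a = sgn b" using a0 E by auto
    have bv: "cmod b \<le> cmod v"
    proof (rule ccontr)
      assume c: "\<not> cmod b \<le> cmod v"
      moreover have "v \<in> closed_segment 0 b"
        using in_radial_iff[OF E(5) t(2)] bs zv zt c by auto
      moreover have "cmod z \<noteq> cmod a" using bs polar_eqI[of z a] zP E aP by auto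
      ultimately show False
        using edge_no_vertex[OF e, of v] P zv bs zb zt by auto
    qed
    have "a \<in> closed_segment u v" "b \<in> closed_segment u v"
      using in_subsegment_iff[OF t(2) uv(3)] in_radial_iff[OF t(2)] E aP zt bs ua bv by auto
    then have "a \<in> S" "b \<in> S" using S(4) uv(4) aP E by auto
    then show ?thesis
      using edge_image[OF e zab] z arc_subset_triod_hull[of "f a" "f ` S" "f b"] by auto
  qed
qed

text \<open>
  By injectivity the cardinality of the traces cannot drop along the cycle; returning to its start, it cannot
  grow either.
\<close>

lemma f_image_block:
  assumes step: "\<forall>x\<in>P. \<forall>y\<in>P. y \<in> C x \<longrightarrow> f y \<in> C (f x)"
    and x: "x \<in> P"
  shows "f ` (P \<inter> C x) = P \<inter> C (f x)" and "y \<in> P \<Longrightarrow> card (P \<inter> C y) = card (P \<inter> C x)"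
proof -
  have sub: "f ` (P \<inter> C x) \<subseteq> P \<inter> C (f x)" if "x \<in> P" for x
    using step that fP by blast
  have inj: "inj_on f (P \<inter> C x)" for x
    using is_cycle_inj[OF cyc] by (rule inj_on_subset) auto
  have le: "card (P \<inter> C x) \<le> card (P \<inter> C (f x))" if "x \<in> P" for x
    using card_inj_on_le[OF inj sub[OF that]] finite_P by auto
  have le': "card (P \<inter> C x) \<le> card (P \<inter> C ((f ^^ k) x))" if "x \<in> P" for x k
    by (induction k) (use le[OF is_cycle_funpow[OF cyc that]] in \<open>auto intro: order_trans\<close>)
  have le'': "card (P \<inter> C x) \<le> card (P \<inter> C y)" if "x \<in> P" "y \<in> P" for x y
    using le'[OF that(1)] is_cycle_transitive[OF cyc that] by metis
  show "y \<in> P \<Longrightarrow> card (P \<inter> C y) = card (P \<inter> C x)"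
    using le'' x by (simp add: order_antisym)
  have "card (f ` (P \<inter> C x)) = card (P \<inter> C (f x))"
    using card_image[OF inj] le''[OF x fP[OF x]] le''[OF fP[OF x] x] by simp
  then show "f ` (P \<inter> C x) = P \<inter> C (f x)"
    using sub[OF x] finite_P by (intro card_subset_eq) auto
qed

text \<open>
  The distinct traces \<open>P \<inter> C x\<close> are the blocks. They are visited cyclically by the iterates of \<open>p\<close>,
  with period \<open>m\<close> say, and so are their hulls. A hull is a segment that \<open>f ^^ m\<close> maps into
  itself; a fixed point of \<open>f ^^ m\<close> in it generates a cycle with exactly one point in each hull.
\<close>

lemma has_block_structure_if_family:
  assumes fam: "\<And>x. x \<in> P \<Longrightarrow> x \<in> C x" "\<And>x. x \<in> P \<Longrightarrow> connected (C x)" "\<And>x. x \<in> P \<Longrightarrow> C x \<subseteq> triod - {0}"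
    and eq: "\<And>x y. x \<in> P \<Longrightarrow> y \<in> P \<Longrightarrow> C x \<inter> C y \<noteq> {} \<Longrightarrow> C x = C y"
    and step: "\<And>x y. x \<in> P \<Longrightarrow> y \<in> P \<Longrightarrow> y \<in> C x \<Longrightarrow> f y \<in> C (f x)"
    and two: "p \<in> P" "q \<in> P" "p \<noteq> q" "q \<in> C p"
  shows "has_block_structure f P"
proof -
  have step': "\<forall>x\<in>P. \<forall>y\<in>P. y \<in> C x \<longrightarrow> f y \<in> C (f x)"
    using step by simp
  define pt where "pt i = (f ^^ i) p" for i
  define c where "c i = C (pt i)" for i
  define Bl where "Bl i = P \<inter> c i" for i
  define H where "H i = triod_hull (Bl i)" for i
  have pt: "pt i \<in> P" for i unfolding pt_def by (rule is_cycle_funpow[OF cyc two(1)])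
  have fpt: "f (pt i) = pt (Suc i)" for i by (simp add: pt_def)
  have pt_add: "(f ^^ j) (pt i) = pt (i + j)" for i j
    by (simp add: pt_def funpow_add add.commute[of i])
  have c_step: "c (Suc i) = c (Suc j)" if "c i = c j" for i j
  proof -
    have "pt j \<in> C (pt i)" using that fam(1)[OF pt[of j]] by (simp add: c_def)
    then have "f (pt j) \<in> C (f (pt i)) \<inter> C (f (pt j))"
      using step pt fam(1) fP by blast
    then show ?thesis using eq[of "f (pt i)" "f (pt j)"] pt unfolding c_def fpt by blast
  qed
  have c_add: "c (i + k) = c (j + k)" if "c i = c j" for i j k
  proof (induction k)
    case (Suc k)
    then show ?case using c_step[of "i + k" "j + k"] by simp
  qed (use that in simp)
  obtain n where n: "n > 0" "(f ^^ n) p = p"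
    using is_cycle_period[OF cyc] two(1) by blast
  \<comment> \<open>the number of blocks: the first return of the orbit of \<open>p\<close> to the class of \<open>p\<close>\<close>
  define m where "m = (LEAST m. m > 0 \<and> c m = c 0)"
  have "n > 0 \<and> c n = c 0" using n by (simp add: c_def pt_def)
  then have m: "m > 0" "c m = c 0" unfolding m_def by (metis (mono_tags, lifting) LeastI)+
  have m_least: "\<not> (0 < l \<and> c l = c 0)" if "l < m" for l
    using not_less_Least[of l "\<lambda>m. m > 0 \<and> c m = c 0"] that by (simp add: m_def)
  have "c (i + m * j) = c i" for i j
  proof (induction j)
    case (Suc j)
    have "c (i + m * Suc j) = c (m + (i + m * j))" by (simp add: algebra_simps)
    also have "\<dots> = c (0 + (i + m * j))" by (rule c_add) (rule m)
    finally show ?case using Suc by simp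
  qed auto
  then have c_mod: "c (i mod m) = c i" for i
    by (metis mod_mult_div_eq)
  \<comment> \<open>applying \<open>f\<close> another \<open>m - j\<close> times to a coincidence \<open>c i = c j\<close> would give an earlier return\<close>
  have c_inj: "i = j" if "i < m" "j < m" "c i = c j" for i j
  proof -
    have "\<not> i < j" if "i < m" "j < m" "c i = c j" for i j
    proof
      assume ij: "i < j"
      have "c (i + (m - j)) = c 0"
        using c_add[OF that(3), of "m - j"] that(2) m(2) by simp
      moreover have "i + (m - j) < m" "0 < i + (m - j)" using ij that by linarith+
      ultimately show False using m_least by blast
    qed
    then show ?thesis using that by (metis linorder_neqE_nat)
  qed
  have c_disj: "c i \<inter> c j = {}" if "i < m" "j < m" "i \<noteq> j" for i j
    using c_inj[OF that(1,2)] that(3) eq[OF pt pt, of i j] by (auto simp: c_def)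
  have Bl: "Bl i \<subseteq> P" "Bl i \<subseteq> c i" "Bl i \<noteq> {}" "finite (Bl i)" for i
    using pt fam(1) finite_P by (auto simp: Bl_def c_def)
  have Hc: "H i \<subseteq> c i" for i
    unfolding H_def using Bl fam pt by (intro triod_hull_subset_connected) (auto simp: c_def)
  have c0: "c i \<subseteq> triod - {0}" for i using fam(3) pt by (simp add: c_def)
  have fBl: "f ` Bl i = Bl (Suc i)" for i
    using f_image_block(1)[OF step' pt[of i]] unfolding Bl_def c_def fpt by blast
  have fH: "f ` H i \<subseteq> H (Suc i)" for i
    unfolding H_def fBl[symmetric]
  proof (rule block_hull_image)
    show "0 \<notin> triod_hull (Bl i)" using Hc[of i] c0[of i] unfolding H_def by blast
    show "P \<inter> triod_hull (Bl i) \<subseteq> Bl i" using Hc[of i] unfolding H_def Bl_def by blast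
  qed (use Bl in auto)
  have Hmod: "H (i mod m) = H i" for i by (simp add: H_def Bl_def c_mod)
  have fnH: "(f ^^ i) x \<in> H i" if "x \<in> H 0" for x i
  proof (induction i)
    case (Suc i)
    then show ?case using fH[of i] by auto
  qed (use that in simp)
  have sg: "sgn x = sgn y" if "x \<in> Bl 0" "y \<in> Bl 0" for x y
  proof (rule sgn_eq_if_zero_notin_hull)
    show "Bl 0 \<subseteq> triod" using Bl P_triod by blast
    show "0 \<notin> triod_hull (Bl 0)" using Hc[of 0] c0[of 0] by (auto simp: H_def)
  qed (use that in auto)
  obtain u v where uv: "u \<in> Bl 0" "v \<in> Bl 0" "u \<in> closed_segment 0 v" "H 0 = closed_segment u v"
    using triod_hull_one_branch[OF Bl(4,3) _ sg] Bl(1) P_triod unfolding H_def by blast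
  have uvP: "u \<in> P" "v \<in> P" using uv Bl by auto
  have H0: "H 0 \<subseteq> tree"
    unfolding uv(4) segment_eq_arc[OF P_triod[OF uvP(2)] uv(3)] using arc_tree verts_tree uvP by blast
  have "continuous_on (H 0) (f ^^ m)" using continuous_funpow H0 by (rule continuous_on_subset)
  moreover have "(f ^^ m) \<in> H 0 \<rightarrow> H 0" using fnH[of _ m] Hmod[of m] by auto
  moreover have "compact (H 0)" "convex (H 0)" "H 0 \<noteq> {}" using uv(4) by auto
  ultimately obtain y where y: "y \<in> H 0" "(f ^^ m) y = y"
    using brouwer[of "H 0" "f ^^ m"] by blast
  define x where "x i = (f ^^ i) y" for i
  define Q where "Q = range x"
  have xH: "x i \<in> H i" for i unfolding x_def using fnH y by blast
  have xmod: "x (i mod m) = x i" for i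
    unfolding x_def by (rule funpow_mod_eq[OF y(2)])
  have Q_eq: "Q = x ` {..<m}"
    unfolding Q_def using xmod m(1) by (metis (mono_tags, lifting) UNIV_I image_eqI image_subsetI lessThan_iff mod_less_divisor subset_UNIV image_mono subset_antisym)
  have x_inj: "i = j" if "i < m" "j < m" "x i \<in> H j" for i j
    using xH[of i] that Hc c_disj by blast
  have "inj_on x {..<m}"
  proof (rule inj_onI)
    fix i j assume "i \<in> {..<m}" "j \<in> {..<m}" "x i = x j"
    then show "i = j" using x_inj[of i j] xH[of j] by simp
  qed
  then have cardQ: "card Q = m"
    unfolding Q_eq by (simp add: card_image)
  have HQ: "H i \<inter> Q = {x i}" if "i < m" for i
    unfolding Q_eq using x_inj[of _ i] xH[of i] that by auto
  have "Q \<subseteq> triod - {0}"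
  proof
    fix z assume "z \<in> Q"
    then obtain i where "z = x i" unfolding Q_def by (rule rangeE)
    then show "z \<in> triod - {0}" using subsetD[OF c0 subsetD[OF Hc xH[of i]]] by simp
  qed
  moreover have "y \<in> Q" unfolding Q_def x_def by (metis funpow_0 rangeI)
  moreover have "Q = range (\<lambda>k. (f ^^ k) y)" by (simp add: Q_def x_def[abs_def])
  ultimately have Qcyc: "is_cycle f Q"
    unfolding is_cycle_def using m(1) y(2) by blast
  have "2 \<le> card (Bl 0)"
  proof -
    have "{p, q} \<subseteq> Bl 0" using two fam(1) by (auto simp: Bl_def c_def pt_def)
    then show ?thesis using card_mono[OF Bl(4)] two(3) by (metis card_2_iff)
  qed
  moreover have "block_structure_over f P Q (card (Bl 0))"
    unfolding block_structure_over_def Let_def cardQ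
  proof (intro conjI exI[of _ Bl] exI[of _ x] Qcyc)
    have "z \<in> (\<Union>i<m. Bl i)" if z: "z \<in> P" for z
    proof -
      obtain j where "z = pt j" using is_cycle_transitive[OF cyc two(1) z] by (auto simp: pt_def)
      then have "z \<in> Bl (j mod m)" using z fam(1)[OF pt[of j]] by (simp add: Bl_def c_mod) (simp add: c_def)
      then show ?thesis using m by auto
    qed
    then show "P = (\<Union>i<m. Bl i)" using Bl(1) by blast
    show "disjoint_family_on Bl {..<m}" "disjoint_family_on (\<lambda>i. triod_hull (Bl i)) {..<m}"
      using c_disj Bl(2) Hc unfolding disjoint_family_on_def H_def by blast+
    show "\<forall>i<m. card (Bl i) = card (Bl 0)"
      using f_image_block(2)[OF step' pt[of 0] pt] unfolding Bl_def c_def by blast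
    show "\<forall>i<m. 0 \<notin> triod_hull (Bl i)" using Hc c0 by (auto simp: H_def)
    show "\<forall>i<m. triod_hull (Bl i) \<inter> Q = {x i}" using HQ by (simp add: H_def)
    show "\<forall>i<m. \<forall>j<m. f (x i) = x j \<longrightarrow> f ` Bl i = Bl j"
    proof (intro allI impI)
      fix i j assume ij: "i < m" "j < m" "f (x i) = x j"
      then have "x j \<in> H (Suc i mod m)" using xH[of "Suc i"] unfolding Hmod by (simp add: x_def)
      then have "j = Suc i mod m" using x_inj[of j "Suc i mod m"] ij m by auto
      then show "f ` Bl i = Bl j" unfolding fBl by (simp add: Bl_def c_mod)
    qed
  qed
  ultimately show ?thesis
    unfolding has_block_structure_def by blast
qed

text \<open>
  The components of \<open>X\<close> at the points of \<open>P\<close> form the required family, because \<open>f\<close> maps connected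
  subsets of \<open>X\<close> to connected subsets of \<open>X\<close>.
\<close>

lemma has_block_structure_if_invariant_set:
  assumes X: "X \<subseteq> triod - {0}" "f ` X \<subseteq> X"
    and ab: "a \<in> P" "b \<in> P" "a \<noteq> b" "connected_component X a b"
  shows "has_block_structure f P"
proof (rule has_block_structure_if_family[of "connected_component_set X" a b])
  have "a \<in> X" using ab(4) connected_component_in by metis
  then have PX: "P \<subseteq> X" by (rule is_cycle_orbit[OF cyc ab(1) _ X(2)])
  then show "\<And>x. x \<in> P \<Longrightarrow> x \<in> connected_component_set X x" by auto
  show "connected_component_set X x \<subseteq> triod - {0}" for x
    using connected_component_subset X(1) by blast
  show "connected_component_set X x = connected_component_set X y"
    if "connected_component_set X x \<inter> connected_component_set X y \<noteq> {}" for x y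
    using that connected_component_nonoverlap[of X x y] by auto
  show "f y \<in> connected_component_set X (f x)" if y: "y \<in> connected_component_set X x" for x y
  proof -
    obtain K where K: "connected K" "K \<subseteq> X" "x \<in> K" "y \<in> K"
      using y by (auto simp: connected_component_def)
    have "connected (f ` K)"
      using K X by (intro connected_continuous_image continuous_on_subset[OF cont]) auto
    moreover have "f ` K \<subseteq> X" using K X by blast
    ultimately show ?thesis using K by (auto simp: connected_component_def intro!: exI[of _ "f ` K"])
  qed
qed (use ab in auto)

text \<open>
  The union of the hulls of the blocks is invariant and does not contain \<open>0\<close>. A block has at
  least two points, so its hull contains an open piece of the tree, and no image of it reaches \<open>0\<close>.
\<close>

lemma not_exact_if_block_structure:
  assumes "has_block_structure f P"
  shows "\<not> topologically_exact tree f"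
proof
  assume ex: "topologically_exact tree f"
  obtain Q k where k: "2 \<le> k" and b: "block_structure_over f P Q k"
    using assms unfolding has_block_structure_def by blast
  then have Q: "is_cycle f Q" unfolding block_structure_over_def by blast
  obtain Bl x where PU: "P = (\<Union>i<card Q. Bl i)"
    and "disjoint_family_on Bl {..<card Q}"
    and cardB: "\<forall>i<card Q. card (Bl i) = k"
    and disj: "disjoint_family_on (\<lambda>i. triod_hull (Bl i)) {..<card Q}"
    and zero: "\<forall>i<card Q. 0 \<notin> triod_hull (Bl i)"
    and xQ: "\<forall>i<card Q. triod_hull (Bl i) \<inter> Q = {x i}"
    and step: "\<forall>i<card Q. \<forall>j<card Q. f (x i) = x j \<longrightarrow> f ` Bl i = Bl j"
    using b unfolding block_structure_over_def Let_def by (elim conjE exE) (rule that; assumption)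
  define m where "m = card Q"
  define H where "H i = triod_hull (Bl i)" for i
  note PU = PU[folded m_def] and cardB = cardB[folded m_def, rule_format]
    and disj = disj[folded m_def H_def] and zero = zero[folded m_def H_def, rule_format]
    and xQ = xQ[folded m_def H_def, rule_format] and step = step[folded m_def, rule_format]
  have Hd: "i = j" if "i < m" "j < m" "z \<in> H i" "z \<in> H j" for i j z
    using disj that unfolding disjoint_family_on_def by (metis IntI empty_iff lessThan_iff)
  have finQ: "finite Q" "Q \<noteq> {}" using is_cycle_finite[OF Q] is_cycle_nonempty[OF Q] by auto
  then have m0: "m > 0" unfolding m_def by (simp add: card_gt_0_iff)
  have "inj_on x {..<m}"
  proof (rule inj_onI)
    fix i j assume "i \<in> {..<m}" "j \<in> {..<m}" "x i = x j"
    then show "i = j" using xQ[of i] xQ[of j] Hd[of i j "x i"] by auto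
  qed
  then have "card (x ` {..<m}) = card Q" by (simp add: card_image m_def)
  moreover have "x ` {..<m} \<subseteq> Q" using xQ by auto
  ultimately have Qx: "x ` {..<m} = Q" using finQ by (metis card_subset_eq)
  have next_block: "\<exists>j<m. f ` Bl i = Bl j" if "i < m" for i
  proof -
    have "x i \<in> Q" using xQ[of i] that by auto
    then have "f (x i) \<in> x ` {..<m}" using is_cycle_closed[OF Q] Qx by auto
    then obtain j where "j < m" "f (x i) = x j" by auto
    then show ?thesis using step[of i j] that by auto
  qed
  have Bl: "Bl i \<subseteq> P" "Bl i \<noteq> {}" if "i < m" for i
    using PU cardB[of i] that k by auto
  have PH: "P \<inter> H i \<subseteq> Bl i" if i: "i < m" for i
  proof
    fix p assume p: "p \<in> P \<inter> H i"
    then obtain j where j: "j < m" "p \<in> Bl j" using PU by auto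
    then have "p \<in> H j" unfolding H_def using subset_triod_hull by blast
    then have "i = j" using Hd[of i j p] p i j by auto
    then show "p \<in> Bl i" using j by simp
  qed
  define X where "X = (\<Union>i<m. H i)"
  have fX: "f ` X \<subseteq> X"
  proof -
    have "f ` H i \<subseteq> X" if i: "i < m" for i
    proof -
      obtain j where j: "j < m" "f ` Bl i = Bl j" using next_block[OF i] by blast
      have "f ` H i \<subseteq> triod_hull (f ` Bl i)"
        using block_hull_image[OF Bl[OF i] zero[OF i, unfolded H_def] PH[OF i, unfolded H_def]] by (simp add: H_def)
      then have "f ` H i \<subseteq> H j" using j by (simp add: H_def)
      then show ?thesis using j unfolding X_def by blast
    qed
    then show ?thesis by (auto simp: X_def)
  qed
  have fnX: "(f ^^ n) ` X \<subseteq> X" for n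
    by (induction n) (use fX in \<open>auto simp: image_subset_iff\<close>)
  have X0: "0 \<notin> X" using zero by (auto simp: X_def)
  have Bt: "Bl 0 \<subseteq> triod" using Bl(1)[OF m0] P_triod by blast
  have sg: "sgn x = sgn y" if "x \<in> Bl 0" "y \<in> Bl 0" for x y
    using sgn_eq_if_zero_notin_hull[OF Bt _ that] zero[OF m0] unfolding H_def by simp
  obtain u v where uv: "u \<in> Bl 0" "v \<in> Bl 0" "u \<in> closed_segment 0 v" "H 0 = closed_segment u v"
    using triod_hull_one_branch[OF _ Bl(2)[OF m0] Bt sg] finite_subset[OF Bl(1)[OF m0] finite_P]
    unfolding H_def by blast
  have uvt: "u \<in> triod" "v \<in> triod" "v \<noteq> 0" using uv Bt Bl(1)[OF m0] P_nonzero by auto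
  have "u \<noteq> v"
  proof
    assume "u = v"
    then have "Bl 0 \<subseteq> {u}" using uv(4) subset_triod_hull[of "Bl 0"] unfolding H_def by simp
    then have "card (Bl 0) \<le> 1" using card_mono[of "{u}" "Bl 0"] by auto
    then show False using k cardB[of 0] m0 by auto
  qed
  then obtain z where z: "z \<in> open_segment u v" by (metis open_segment_eq_empty ex_in_conv)
  \<comment> \<open>the hull without its end points is open in the tree, being given by bounds on one coordinate\<close>
  define U where "U = tree \<inter> coord (sgn v) -` {cmod u<..<cmod v}"
  have opU: "openin (top_of_set tree) U"
    unfolding U_def by (intro continuous_openin_preimage_gen continuous_on_coord) auto
  have wd: "sgn v \<in> dirs" using sgn_in_dirs uvt by auto
  have "H 0 \<subseteq> tree"
    using arc_tree[of u v] verts_tree uv Bl(1)[OF m0] segment_eq_arc[OF uvt(2) uv(3)] by auto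
  have "z \<in> U"
  proof -
    have zc: "z \<in> closed_segment u v" "z \<noteq> u" "z \<noteq> v" using z by (auto simp: open_segment_def)
    then have zz: "z \<in> closed_segment 0 v" "cmod u \<le> cmod z" using in_subsegment_iff[OF uvt(2) uv(3)] by auto
    have u0: "u \<noteq> 0" using uv Bl(1)[OF m0] P_nonzero by auto
    then have z0: "z \<noteq> 0" using zz by auto
    have s: "sgn z = sgn v" "cmod z \<le> cmod v" "z \<in> triod" using radial_subset_triod[OF uvt(2) zz(1)] z0 by auto
    have "cmod z \<noteq> cmod v" using s polar_eqI zc by blast
    moreover have "cmod z \<noteq> cmod u" using s polar_eqI[of z u] zc sg[OF uv(1,2)] by auto
    ultimately have "cmod u < cmod z" "cmod z < cmod v" using zz s by auto
    then show ?thesis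
      using \<open>H 0 \<subseteq> tree\<close> zc uv(4) coord_eq[OF s(3) wd] s by (auto simp: U_def)
  qed
  have "U \<subseteq> X"
  proof
    fix z assume z: "z \<in> U"
    then have zt: "z \<in> triod" and zc: "cmod u < coord (sgn v) z" "coord (sgn v) z < cmod v"
      using tree_triod by (auto simp: U_def)
    have "coord (sgn v) z > 0" using zc(1) norm_ge_zero[of u] by linarith
    then have "sgn z = sgn v" "cmod z = coord (sgn v) z" using coord_pos_imp[OF zt wd] by auto
    then have "z \<in> closed_segment u v"
      using in_subsegment_iff[OF uvt(2) uv(3)] in_radial_iff[OF uvt(2) zt] zc by auto
    then show "z \<in> X" using uv m0 by (auto simp: X_def)
  qed
  obtain n where "(f ^^ n) ` U = tree"
    using ex opU \<open>z \<in> U\<close> unfolding topologically_exact_def by blast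
  then have "0 \<in> X" using fnX[of n] \<open>U \<subseteq> X\<close> verts_tree[of 0] by auto
  then show False using X0 by simp
qed

section \<open>Points that no vertex ever separates\<close>

text \<open>
  The Markov property: an arc between vertices that contains two different points of an edge
  contains the whole edge. It is stated as additivity of lengths, which at the same time
  compares the lengths of arc and edge. The reason is that the coordinate of the branch of the edge, at a vertex, is
  never strictly between its values at \<open>u\<close> and \<open>v\<close>.
\<close>

lemma edge_between:
  assumes e: "edge u v" and st: "s \<in> verts" "t \<in> verts"
    and xy: "x \<in> closed_segment u v" "y \<in> closed_segment u v" "x \<noteq> y" "x \<in> triod_arc s t" "y \<in> triod_arc s t"
  shows "tdist s t = tdist s u + tdist u v + tdist v t \<or> tdist s t = tdist s v + tdist v u + tdist u t"
proof -
  note E = edgeD[OF e]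
  define w where "w = sgn v"
  have v0: "v \<noteq> 0" using E P_nonzero by auto
  have w: "w \<in> dirs" using sgn_in_dirs[OF E(5) v0] by (simp add: w_def)
  have seg: "coord w z = cmod z" "cmod u \<le> cmod z" "cmod z \<le> cmod v" "z \<noteq> 0 \<longrightarrow> sgn z = w"
    if z: "z \<in> closed_segment u v" for z
  proof -
    have z0: "z \<in> closed_segment 0 v" and ge: "cmod u \<le> cmod z"
      using in_subsegment_iff[OF E(5,4)] z by auto
    note r = radial_subset_triod[OF E(5) z0]
    show "coord w z = cmod z" using coord_eq[OF r(1) w] r(2) by (cases "z = 0") (auto simp: w_def)
    show "cmod u \<le> cmod z" "cmod z \<le> cmod v" by (fact ge) (fact r(3))
    show "z \<noteq> 0 \<longrightarrow> sgn z = w" using r(2) by (simp add: w_def)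
  qed
  have ne: "cmod x \<noteq> cmod y"
  proof
    assume a: "cmod x = cmod y"
    then have "sgn x = sgn y" using seg(4)[OF xy(1)] seg(4)[OF xy(2)] by (cases "x = 0") auto
    then show False using a polar_eqI xy(3) by blast
  qed
  have gap: "coord w p \<le> cmod u \<or> cmod v \<le> coord w p" if p: "p \<in> verts" for p
  proof (rule ccontr)
    assume a: "\<not> ?thesis"
    have pt: "p \<in> triod" using verts_triod p by blast
    have "0 < coord w p" using a norm_ge_zero[of u] by linarith
    then have "sgn p = w" "cmod p = coord w p" using coord_pos_imp[OF pt w] by auto
    then show False
      using edge_no_vertex[OF e p] in_radial_iff[OF E(5) pt] a by (auto simp: w_def)
  qed
  have *: "tdist s t = tdist s u + tdist u v + tdist v t"
    if st: "s \<in> verts" "t \<in> verts" and le: "coord w s \<le> cmod u" and ge: "cmod v \<le> coord w t" for s t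
  proof -
    have tt: "t \<in> triod" "s \<in> triod" using st verts_triod by auto
    have cu: "coord w' u = (if w' = w then cmod u else 0)" and cv: "coord w' v = (if w' = w then cmod v else 0)"
      if "w' \<in> dirs" for w'
      using coord_eq[OF E(6) that] coord_eq[OF E(5) that] E(10) by (cases "u = 0"; auto simp: w_def)+
    have "0 < coord w t" using ge v0 zero_less_norm_iff[of v] by linarith
    then have "sgn t = w" using coord_pos_imp[OF tt(1) w] by auto
    then have ct: "coord w' t = (if w' = w then coord w t else 0)" if "w' \<in> dirs" for w'
      using coord_eq[OF tt(1) that] by auto
    have "u \<in> triod_arc s t"
      unfolding triod_arc_def using E(6) cu ct le ge E(9) coord_nonneg by (auto simp: min_le_iff_disj le_max_iff_disj)
    moreover have "v \<in> triod_arc u t"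
      unfolding triod_arc_def using E(5) cu cv ct ge E(9) by (auto simp: min_le_iff_disj le_max_iff_disj)
    ultimately show ?thesis
      using arc_iff_tdist[OF tt(2,1) E(6)] arc_iff_tdist[OF E(6) tt(1) E(5)] by linarith
  qed
  have "min (coord w s) (coord w t) \<le> cmod x" "min (coord w s) (coord w t) \<le> cmod y"
    "cmod x \<le> max (coord w s) (coord w t)" "cmod y \<le> max (coord w s) (coord w t)"
    using xy(4,5) w seg(1)[OF xy(1)] seg(1)[OF xy(2)] by (auto simp: triod_arc_def)
  then have "min (coord w s) (coord w t) < cmod v" "cmod u < max (coord w s) (coord w t)"
    using ne seg(2,3)[OF xy(1)] seg(2,3)[OF xy(2)] by linarith+
  then have "coord w s \<le> cmod u \<and> cmod v \<le> coord w t \<or> coord w t \<le> cmod u \<and> cmod v \<le> coord w s"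
    using gap[OF st(1)] gap[OF st(2)] E(9) by (auto simp: min_def max_def split: if_splits)
  then show ?thesis
  proof (elim disjE conjE)
    assume "coord w t \<le> cmod u" "cmod v \<le> coord w s"
    then show ?thesis
      using *[OF st(2,1)] tdist_commute[of t s] tdist_commute[of t u] tdist_commute[of u v]
        tdist_commute[of v s] by linarith
  qed (use *[OF st] in blast)
qed

lemma edge_length:
  assumes e: "edge u v" and st: "s \<in> verts" "t \<in> verts"
    and xy: "x \<in> closed_segment u v" "y \<in> closed_segment u v" "x \<noteq> y" "x \<in> triod_arc s t" "y \<in> triod_arc s t"
  shows "tdist u v \<le> tdist s t" and "tdist s t = tdist u v \<Longrightarrow> {s, t} = {u, v}"
proof -
  note E = edgeD[OF e]
  have t: "s \<in> triod" "t \<in> triod" using st verts_triod by auto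
  note b = edge_between[OF assms]
  note nn = tdist_nonneg[of s u] tdist_nonneg[of v t] tdist_nonneg[of s v] tdist_nonneg[of u t] tdist_commute[of u v]
  show "tdist u v \<le> tdist s t" using b nn by linarith
  assume eq: "tdist s t = tdist u v"
  then have "tdist s u = 0 \<and> tdist v t = 0 \<or> tdist s v = 0 \<and> tdist u t = 0"
    using b nn by linarith
  then show "{s, t} = {u, v}"
    using tdist_pos_iff t E(5,6) by auto
qed

text \<open>
  Let \<open>r n\<close> be the length of the arc between the \<open>n\<close>-th images of \<open>x\<close> and \<open>y\<close>, divided by the
  length of the edge containing it. Since \<open>f\<close> stretches this edge onto an arc that contains the next
  edge, \<open>r\<close> is multiplied in each step by some \<open>q n \<ge> 1\<close>, the quotient of the lengths of that
  arc and of the next edge. As \<open>r\<close> is bounded, \<open>q\<close> tends to \<open>1\<close>; having finitely many values, it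
  equals \<open>1\<close> eventually, and then the arc is the next edge.
\<close>

lemma unseparated_forever_imp_edge_loop:
  assumes xy: "x \<in> tree" "y \<in> tree" "x \<noteq> y" and unseparated: "\<And>n. unseparated ((f ^^ n) x) ((f ^^ n) y)"
  shows "\<exists>u v. \<forall>n. edge ((f ^^ n) u) ((f ^^ n) v) \<or> edge ((f ^^ n) v) ((f ^^ n) u)"
proof -
  define X where "X n = (f ^^ n) x" for n
  define Y where "Y n = (f ^^ n) y" for n
  have XS: "X (Suc n) = f (X n)" "Y (Suc n) = f (Y n)" for n by (auto simp: X_def Y_def)
  have XT: "X n \<in> tree" "Y n \<in> tree" for n using funpow_tree xy by (auto simp: X_def Y_def)
  have Dpos: "0 < tdist (f u) (f v)" "0 < tdist u v" if e: "edge u v" for u v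
  proof -
    note E = edgeD[OF e]
    have "f u \<noteq> f v" using f_inj_verts[OF E(1)] E(2,3) by auto
    then have "tdist (f u) (f v) \<noteq> 0" "tdist u v \<noteq> 0"
      using tdist_pos_iff E maps by auto
    then show "0 < tdist (f u) (f v)" "0 < tdist u v" using tdist_nonneg by (simp_all add: less_le)
  qed
  have XY: "X n \<noteq> Y n" for n
  proof (induction n)
    case 0
    then show ?case using xy by (simp add: X_def Y_def)
  next
    case (Suc n)
    have "unseparated (X n) (Y n)" using unseparated by (simp add: X_def Y_def)
    then obtain u v where e: "edge u v" "X n \<in> closed_segment u v" "Y n \<in> closed_segment u v"
      using unseparated_imp_edge[OF XT Suc] by blast
    have "tdist (X n) (Y n) \<noteq> 0" using tdist_pos_iff tree_triod XT Suc by blast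
    then have "tdist (f (X n)) (f (Y n)) * tdist u v \<noteq> 0"
      using edge_affine[OF e] Dpos[OF e(1)] by simp
    then show ?case unfolding XS using tdist_pos_iff tree_triod f_tree XT by (metis mult_zero_left)
  qed
  have "\<forall>n. \<exists>u v. edge u v \<and> X n \<in> closed_segment u v \<and> Y n \<in> closed_segment u v"
    using unseparated_imp_edge[OF XT XY] unseparated by (simp add: X_def Y_def)
  then obtain U V where e: "\<And>n. edge (U n) (V n)" and UV: "\<And>n. X n \<in> closed_segment (U n) (V n)"
      "\<And>n. Y n \<in> closed_segment (U n) (V n)"
    by metis
  note E = edgeD[OF e]
  define len where "len n = tdist (U n) (V n)" for n
  define D where "D n = tdist (f (U n)) (f (V n))" for n
  define r where "r n = tdist (X n) (Y n) / len n" for n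
  define q where "q n = D n / len (Suc n)" for n
  have len: "0 < len n" and D: "0 < D n" for n using Dpos[OF e] by (auto simp: len_def D_def)
  have fUV: "f (U n) \<in> verts" "f (V n) \<in> verts" for n using f_verts E(1,2) by blast+
  have im: "X (Suc n) \<in> triod_arc (f (U n)) (f (V n))" "Y (Suc n) \<in> triod_arc (f (U n)) (f (V n))" for n
    unfolding XS using edge_image[OF e] UV by blast+
  have rq: "r (Suc n) = q n * r n" for n
  proof -
    have "tdist (X (Suc n)) (Y (Suc n)) * len n = D n * tdist (X n) (Y n)"
      unfolding XS len_def D_def by (rule edge_affine[OF e UV])
    then show ?thesis using len[of n] len[of "Suc n"] by (simp add: r_def q_def field_simps)
  qed
  have q1: "1 \<le> q n" for n
    using edge_length(1)[OF e fUV UV XY im] len[of "Suc n"] by (simp add: q_def len_def D_def)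
  have rpos: "0 < r n" for n
  proof -
    have "tdist (X n) (Y n) \<noteq> 0" using tdist_pos_iff tree_triod XT XY by blast
    then show ?thesis using tdist_nonneg[of "X n" "Y n"] len by (simp add: r_def less_le)
  qed
  have r1: "r n \<le> 1" for n
  proof -
    have "tdist (X n) (Y n) \<le> tdist (U n) (V n)"
      using tdist_le_arc[OF E(6,5)] UV E(7) by auto
    then show ?thesis using len[of n] by (simp add: r_def len_def)
  qed
  have inc: "r n \<le> r (Suc n)" for n
    using mult_right_mono[OF q1[of n], of "r n"] rpos[of n] by (simp add: rq)
  then have "incseq r" by (rule incseq_SucI)
  then obtain L where L: "r \<longlonglongrightarrow> L" "\<And>n. r n \<le> L"
    using incseq_convergent[of r 1] r1 by auto
  have Lpos: "L \<noteq> 0" using L(2)[of 0] rpos[of 0] by linarith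
  have "(\<lambda>n. r (Suc n) / r n) \<longlonglongrightarrow> L / L"
    using L(1) LIMSEQ_Suc[OF L(1)] Lpos by (intro tendsto_divide)
  moreover have "r (Suc n) / r n = q n" for n using rpos[of n] by (simp add: rq)
  ultimately have qlim: "q \<longlonglongrightarrow> 1" using Lpos by simp
  define F where "F = (\<lambda>(a, b, c, d). tdist (f a) (f b) / tdist c d) ` (verts \<times> verts \<times> verts \<times> verts) - {1}"
  have "finite F" unfolding F_def using finite_verts by (intro finite_Diff finite_imageI finite_cartesian_product)
  then have "open (- F)" by (simp add: finite_imp_closed open_Compl)
  moreover have "1 \<in> - F" by (simp add: F_def)
  ultimately have "\<forall>\<^sub>F n in sequentially. q n \<in> - F"
    using qlim by (rule topological_tendstoD[rotated])
  then obtain N where N: "\<And>n. n \<ge> N \<Longrightarrow> q n \<notin> F" by (auto simp: eventually_sequentially)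
  have step: "{f (U n), f (V n)} = {U (Suc n), V (Suc n)}" if "n \<ge> N" for n
  proof -
    have "q n = (\<lambda>(a, b, c, d). tdist (f a) (f b) / tdist c d) (U n, V n, U (Suc n), V (Suc n))"
      by (simp add: q_def D_def len_def)
    moreover have "(U n, V n, U (Suc n), V (Suc n)) \<in> verts \<times> verts \<times> verts \<times> verts"
      using E(1,2) by blast
    ultimately have "q n = 1" using N[OF that] unfolding F_def by blast
    then have "D n = len (Suc n)" using len[of "Suc n"] by (simp add: q_def)
    then show ?thesis
      using edge_length(2)[OF e fUV UV XY im] by (simp add: D_def len_def)
  qed
  have "{(f ^^ k) (U N), (f ^^ k) (V N)} = {U (N + k), V (N + k)}" for k
  proof (induction k)
    case (Suc k)
    have "{(f ^^ Suc k) (U N), (f ^^ Suc k) (V N)} = f ` {(f ^^ k) (U N), (f ^^ k) (V N)}" by simp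
    also have "\<dots> = {f (U (N + k)), f (V (N + k))}" unfolding Suc by simp
    also have "\<dots> = {U (N + Suc k), V (N + Suc k)}" using step[of "N + k"] by simp
    finally show ?case .
  qed simp
  then have "edge ((f ^^ k) (U N)) ((f ^^ k) (V N)) \<or> edge ((f ^^ k) (V N)) ((f ^^ k) (U N))" for k
    using e[of "N + k"] by (metis doubleton_eq_iff)
  then show ?thesis by blast
qed

lemma primitive_cycle_if_edges_at_zero:
  assumes "\<And>p. p \<in> P \<Longrightarrow> edge 0 p"
  shows "primitive_cycle P"
  unfolding primitive_cycle_def
proof (intro ballI impI notI)
  fix x y assume xy: "x \<in> P" "y \<in> P" "x \<noteq> y" "\<exists>B\<in>branches. x \<in> B \<and> y \<in> B"
  then have s: "sgn x = sgn y" using same_branch_iff P_triod by blast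
  have *: False if "x \<in> P" "y \<in> P" "sgn x = sgn y" "cmod x < cmod y" for x y
  proof -
    have "x \<in> closed_segment 0 y" using in_radial_iff[of y x] that P_triod by auto
    then show False using edge_no_vertex[OF assms[OF that(2)], of x] that P_nonzero by auto
  qed
  have "cmod x \<noteq> cmod y" using s polar_eqI xy(3) by blast
  then show False using *[OF xy(1,2) s] *[OF xy(2,1) s[symmetric]] by linarith
qed

text \<open>
  If one of the edges had \<open>0\<close> as an end, all of them would, because \<open>0\<close> is fixed; every point of
  \<open>P\<close> would then be the first one on its branch, and \<open>P\<close> would be primitive. So the union of
  the edges is an invariant set that avoids \<open>0\<close> and joins two points of \<open>P\<close>.
\<close>

lemma has_block_structure_if_edge_loop:
  assumes notprim: "\<not> primitive_cycle P"
    and loop: "\<And>n. edge ((f ^^ n) u) ((f ^^ n) v) \<or> edge ((f ^^ n) v) ((f ^^ n) u)"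
  shows "has_block_structure f P"
proof -
  define A where "A n = triod_arc ((f ^^ n) u) ((f ^^ n) v)" for n
  have *: "\<exists>a b. edge a b \<and> {a, b} = {(f ^^ n) u, (f ^^ n) v} \<and> A n = closed_segment a b" for n
    using loop[of n] edgeD(7) arc_commute unfolding A_def by (metis insert_commute)
  have uv: "u \<in> verts" "v \<in> verts" "u \<noteq> v" using loop[of 0] edgeD[of u v] edgeD[of v u] by auto
  have zero: "(f ^^ n) 0 = 0" for n by (induction n) auto
  have nz: False if z: "z = 0" "z \<in> {u, v}" for z
  proof -
    obtain p where p: "{u, v} = {0, p}" "p \<in> P" using z uv by (cases "u = 0") auto
    have ep: "edge 0 ((f ^^ n) p)" for n
    proof -
      have "edge 0 ((f ^^ n) p) \<or> edge ((f ^^ n) p) 0"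
        using loop[of n] p(1) zero[of n] by (metis doubleton_eq_iff)
      then show ?thesis using edgeD(2)[of _ 0] P_nonzero by blast
    qed
    have "edge 0 q" if "q \<in> P" for q
      using is_cycle_transitive[OF cyc p(2) that] ep by auto
    then show False using primitive_cycle_if_edges_at_zero notprim by blast
  qed
  then have P: "u \<in> P" "v \<in> P" using uv by auto
  define X where "X = (\<Union>n. A n)"
  show ?thesis
  proof (rule has_block_structure_if_invariant_set[of X u v])
    show "X \<subseteq> triod - {0}"
    proof -
      have "0 \<notin> A n" for n
      proof
        assume a0: "0 \<in> A n"
        obtain a b where ab: "edge a b" "{a, b} = {(f ^^ n) u, (f ^^ n) v}" "A n = closed_segment a b"
          using * by blast
        have "a \<in> P" using ab(2) is_cycle_funpow[OF cyc P(1)] is_cycle_funpow[OF cyc P(2)] by (metis insertE insertI1 singletonD)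
        moreover have "cmod a \<le> cmod 0"
          using in_subsegment_iff[OF edgeD(5,4)[OF ab(1)], of 0] a0 ab(3) by blast
        ultimately show False using P_nonzero by auto
      qed
      then show ?thesis unfolding X_def A_def using arc_subset_triod by blast
    qed
    show "f ` X \<subseteq> X"
    proof -
      have "f ` A n \<subseteq> A (Suc n)" for n
      proof
        fix z' assume "z' \<in> f ` A n"
        then obtain z where z: "z \<in> A n" "z' = f z" by blast
        obtain a b where ab: "edge a b" "{a, b} = {(f ^^ n) u, (f ^^ n) v}" "A n = closed_segment a b"
          using * by blast
        have "f z \<in> triod_arc (f a) (f b)" using edge_image[OF ab(1)] z ab(3) by blast
        then show "z' \<in> A (Suc n)"
          using ab(2) z arc_commute unfolding A_def by (auto simp: doubleton_eq_iff)
      qed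
      then show ?thesis unfolding X_def by blast
    qed
    obtain a b where ab: "edge a b" "{a, b} = {u, v}" "A 0 = closed_segment a b"
      using *[of 0] by auto
    have "connected (A 0)" "A 0 \<subseteq> X" using ab by (auto simp: X_def)
    moreover have "u \<in> A 0" "v \<in> A 0" using P P_triod left_in_arc right_in_arc by (auto simp: A_def)
    ultimately show "connected_component X u v" unfolding connected_component_def by blast
  qed (use P uv in auto)
qed

end

section \<open>Fixed points and primitive cycles of period 2\<close>

lemma ray_point:
  assumes "w \<in> dirs" "0 \<le> t" "t \<le> 1"
  shows "of_real t * w \<in> triod" "cmod (of_real t * w) = t" "t \<noteq> 0 \<Longrightarrow> sgn (of_real t * w) = w"
proof -
  show n: "cmod (of_real t * w) = t"
    using assms norm_dirs by (simp add: norm_mult)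
  show s: "sgn (of_real t * w) = w" if "t \<noteq> 0"
    using that assms norm_dirs[OF assms(1)] by (simp add: sgn_div_norm norm_mult scaleR_conv_of_real)
  show "of_real t * w \<in> triod"
    using n s assms by (cases "t = 0") (auto simp: triod_iff)
qed

lemma triod_norm_le_1: "z \<in> triod \<Longrightarrow> cmod z \<le> 1"
  by (auto simp: triod_iff)

lemma sgn_eq_cases: "z \<in> triod \<Longrightarrow> sgn z = w \<Longrightarrow> of_real (cmod z) * w = z"
  using polar by metis

lemma coord_point:
  assumes "z \<in> triod" "w \<in> dirs"
  shows "of_real (coord w z) * w = (if sgn z = w then z else 0)"
  using coord_eq[OF assms] sgn_eq_cases[OF assms(1)] by auto

lemma coord_fixed:
  assumes "w \<in> dirs" "0 < t" "z \<in> triod" "coord w z = t"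
  shows "z = of_real t * w"
  using coord_pos_imp[of z w] assms sgn_eq_cases[of z w] by auto

lemma ivt_fixed_point:
  fixes g :: "real \<Rightarrow> real"
  assumes "a \<le> b" "continuous_on {a..b} g" "a \<le> g a" "g b \<le> b"
  shows "\<exists>t. a \<le> t \<and> t \<le> b \<and> g t = t"
proof -
  have "\<exists>t\<ge>a. t \<le> b \<and> g t - t = 0"
    by (rule IVT2') (use assms in \<open>auto intro!: continuous_intros\<close>)
  then show ?thesis by auto
qed

lemma continuous_coord_ray:
  assumes f: "continuous_on triod f" and w: "w \<in> dirs" and ab: "0 \<le> a" "b \<le> 1"
  shows "continuous_on {a..b} (\<lambda>t. coord w' (f (of_real t * w)))"
proof -
  have "continuous_on ((\<lambda>t. of_real t * w) ` {a..b}) f"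
    using f by (rule continuous_on_subset) (use ray_point[OF w] ab in auto)
  then have "continuous_on {a..b} (\<lambda>t. f (of_real t * w))"
    by (rule continuous_on_compose2) (auto intro!: continuous_intros)
  then show ?thesis unfolding coord_def by (intro continuous_intros)
qed

text \<open>
  If \<open>f\<close> did not move \<open>x\<close> inwards or off its branch, there would be a fixed point between \<open>x\<close> and the
  outermost point of \<open>P\<close> on the branch, which cannot be moved outwards. The images may leave the
  branch in between, but a fixed point of the coordinate other than \<open>0\<close> is a fixed point of \<open>f\<close>.
\<close>

lemma coord_less_if_no_fixed_point:
  assumes cont: "continuous_on triod f" and maps: "\<And>x. x \<in> triod \<Longrightarrow> f x \<in> triod"
    and nofix: "\<And>x. x \<in> triod \<Longrightarrow> f x = x \<Longrightarrow> x = 0"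
    and cyc: "is_cycle f P" and v: "v \<in> P" and x: "x \<in> closed_segment 0 v" "x \<noteq> 0"
  shows "coord (sgn x) (f x) < cmod x"
proof (rule ccontr)
  assume "\<not> coord (sgn x) (f x) < cmod x"
  then have ge: "cmod x \<le> coord (sgn x) (f x)" by simp
  have Pt: "p \<in> triod" if "p \<in> P" for p using is_cycle_subset[OF cyc] that by auto
  have vt: "v \<in> triod" by (rule Pt[OF v])
  have xt: "x \<in> triod" "sgn x = sgn v" "cmod x \<le> cmod v" using radial_subset_triod[OF vt x(1)] x by auto
  define w where "w = sgn x"
  have w: "w \<in> dirs" unfolding w_def by (rule sgn_in_dirs[OF xt(1) x(2)])
  let ?A = "{p \<in> P. sgn p = w}"
  have "finite ?A" "v \<in> ?A" using is_cycle_finite[OF cyc] v xt by (auto simp: w_def)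
  then obtain e where e: "e \<in> ?A" "\<And>p. p \<in> ?A \<Longrightarrow> cmod p \<le> cmod e"
    using ex_max_norm[of ?A] by blast
  have et: "e \<in> triod" "f e \<in> P" using e Pt is_cycle_closed[OF cyc] by auto
  let ?g = "\<lambda>t. coord w (f (of_real t * w))"
  have "\<exists>t. cmod x \<le> t \<and> t \<le> cmod e \<and> ?g t = t"
  proof (rule ivt_fixed_point)
    show "cmod x \<le> cmod e" using e(2)[of v] v xt w_def by auto
    show "continuous_on {cmod x..cmod e} ?g"
      by (rule continuous_coord_ray[OF cont w]) (use triod_norm_le_1[OF et(1)] in auto)
    show "cmod x \<le> ?g (cmod x)" using ge sgn_eq_cases[OF xt(1), of w] by (simp add: w_def)
    have "?g (cmod e) = coord w (f e)" using sgn_eq_cases[OF et(1), of w] e by simp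
    also have "\<dots> \<le> cmod e" using coord_eq[OF Pt[OF et(2)] w] e(2)[of "f e"] et by auto
    finally show "?g (cmod e) \<le> cmod e" .
  qed
  then obtain t where t: "cmod x \<le> t" "t \<le> cmod e" "?g t = t" by blast
  have t01: "0 < t" "t \<le> 1"
    using t(1,2) triod_norm_le_1[OF et(1)] x(2) zero_less_norm_iff[of x] by linarith+
  note r = ray_point[OF w less_imp_le[OF t01(1)] t01(2)]
  have "f (of_real t * w) = of_real t * w"
    by (rule coord_fixed[OF w t01(1) maps[OF r(1)] t(3)])
  then have "of_real t * w = 0" by (rule nofix[OF r(1)])
  then show False using r(2) t01 by simp
qed

text \<open>
  Otherwise the point of \<open>P\<close> nearest to \<open>0\<close> would not be moved inwards on the only branch.
\<close>

lemma cycle_meets_two_branches: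
  assumes cont: "continuous_on triod f" and maps: "\<And>x. x \<in> triod \<Longrightarrow> f x \<in> triod"
    and nofix: "\<And>x. x \<in> triod \<Longrightarrow> f x = x \<Longrightarrow> x = 0"
    and cyc: "is_cycle f P"
  shows "\<exists>x\<in>P. \<exists>y\<in>P. sgn x \<noteq> sgn y"
proof (rule ccontr)
  assume a: "\<not> ?thesis"
  obtain u where u: "u \<in> P" "\<And>p. p \<in> P \<Longrightarrow> cmod u \<le> cmod p"
    using ex_min_norm[OF is_cycle_finite[OF cyc] is_cycle_nonempty[OF cyc]] by blast
  have ut: "u \<in> triod" "u \<noteq> 0" using u is_cycle_subset[OF cyc] by auto
  have fu: "f u \<in> P" using is_cycle_closed[OF cyc] u by blast
  have "coord (sgn u) (f u) = cmod (f u)"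
  proof -
    have "sgn (f u) = sgn u" using a fu u(1) by blast
    then show ?thesis using coord_eq[OF maps[OF ut(1)] sgn_in_dirs[OF ut]] by simp
  qed
  moreover have "coord (sgn u) (f u) < cmod u"
    by (rule coord_less_if_no_fixed_point[OF cont maps nofix cyc u(1)]) (use ut in auto)
  ultimately show False using u(2)[OF fu] by simp
qed

text \<open>
  Otherwise \<open>x\<close> and \<open>f x\<close> would form a primitive cycle of period 2. All cycles of its pattern are
  primitive of period 2 as well, since equivalences preserve branches, and a pattern forces itself.
\<close>

lemma regular_map_no_primitive_2_cycle:
  assumes f: "f \<in> regular_maps" and x: "x \<in> triod" "f (f x) = x"
  shows "sgn (f x) = sgn x"
proof (rule ccontr)
  assume ne: "sgn (f x) \<noteq> sgn x"
  have fU: "f \<in> triod_maps" using f by (simp add: regular_maps_def)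
  define y where "y = f x"
  have f0: "f 0 = 0" and yt: "y \<in> triod" using fU x by (auto simp: triod_maps_def y_def)
  have fy: "f y = x" "sgn y \<noteq> sgn x" using x ne by (auto simp: y_def)
  then have nz: "x \<noteq> 0" "y \<noteq> 0" using f0 y_def by auto
  have it: "(f ^^ k) x = (if even k then x else y)" for k
    by (induction k) (use fy in \<open>auto simp: y_def\<close>)
  have "range (\<lambda>k. (f ^^ k) x) = {x, y}"
  proof
    show "{x, y} \<subseteq> range (\<lambda>k. (f ^^ k) x)"
      using it[of 0] it[of 1] by (metis empty_subsetI insert_subset rangeI even_zero odd_one)
  qed (use it in auto)
  then have cyc: "is_cycle f {x, y}"
    unfolding is_cycle_def using x yt nz it[of 2]
    by (intro conjI bexI[of _ x] exI[of _ 2]) auto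
  define B where "B = pattern_of f {x, y}"
  have *: "primitive_cycle Q \<and> card Q = 2" if gQ: "(g, Q) \<in> B" for g Q
  proof -
    obtain h where h: "\<And>b. b \<in> branches \<Longrightarrow> h ` (triod_hull {x, y} \<inter> b) = triod_hull Q \<inter> b" "h ` {x, y} = Q"
      and Q: "is_cycle g Q"
      using gQ unfolding B_def pattern_of_def cycle_equiv_def by blast
    have hs: "sgn (h z) = sgn z" if z: "z \<in> {x, y}" for z
    proof -
      have zt: "z \<in> triod" "z \<noteq> 0" using z x yt nz by auto
      then obtain b where b: "b \<in> branches" "z \<in> b" using same_branch_iff[of z z] by blast
      have "z \<in> triod_hull {x, y}" using z subset_triod_hull by blast
      then have "h z \<in> b" using h(1)[OF b(1)] b(2) by blast
      moreover have "h z \<in> triod" using h(2) z is_cycle_subset[OF Q] by auto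
      ultimately show ?thesis using same_branch_iff[of z "h z"] zt b by auto
    qed
    have Qh: "Q = {h x, h y}" using h(2) by auto
    have "h x \<in> triod" "h y \<in> triod" using is_cycle_subset[OF Q] Qh by auto
    then have "primitive_cycle Q"
      unfolding primitive_cycle_def Qh using hs[of x] hs[of y] fy
        same_branch_iff[of "h x" "h y"] same_branch_iff[of "h y" "h x"] by auto
    moreover have "card Q = 2" unfolding Qh using hs[of x] hs[of y] fy by (metis card_2_iff insertI1 insert_commute)
    ultimately show ?thesis by simp
  qed
  have "B \<in> patterns" unfolding patterns_def B_def using fU cyc by blast
  moreover have "primitive_pattern B" "has_period B 2" "forces B B"
    using * unfolding primitive_pattern_def has_period_def forces_def by auto
  ultimately have "\<not> regular_pattern (pattern_of f {x, y})"
    unfolding regular_pattern_def B_def by blast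
  then show False using f cyc unfolding regular_maps_def by blast
qed

section \<open>The cyclic order in which the branches follow each other\<close>

locale regular_linear_cycle = linear_cycle +
  assumes nofix: "\<And>x. x \<in> triod \<Longrightarrow> f x = x \<Longrightarrow> x = 0"
    and no_primitive_2_cycle: "\<And>x. x \<in> triod \<Longrightarrow> f (f x) = x \<Longrightarrow> sgn (f x) = sgn x"
begin

definition innermost :: "complex \<Rightarrow> complex" where
  "innermost w = (SOME a. a \<in> P \<and> sgn a = w \<and> (\<forall>p\<in>P. sgn p = w \<longrightarrow> cmod a \<le> cmod p))"

text \<open>
  The branch into which \<open>f\<close> maps the edge at \<open>0\<close> of direction \<open>w\<close>. Like \<open>innermost\<close>, this is
  meaningful for the directions that occur in \<open>P\<close>; they turn out to be all three.
\<close>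

definition next_dir :: "complex \<Rightarrow> complex" where
  "next_dir w = sgn (f (innermost w))"

lemma innermost:
  assumes "w \<in> sgn ` P"
  shows "innermost w \<in> P" "sgn (innermost w) = w" "\<And>p. p \<in> P \<Longrightarrow> sgn p = w \<Longrightarrow> cmod (innermost w) \<le> cmod p"
proof -
  let ?A = "{p \<in> P. sgn p = w}"
  have "finite ?A" "?A \<noteq> {}" using assms finite_P by auto
  then obtain a where "a \<in> ?A" "\<forall>p\<in>?A. cmod a \<le> cmod p" using ex_min_norm[of ?A] by blast
  then have "\<exists>a. a \<in> P \<and> sgn a = w \<and> (\<forall>p\<in>P. sgn p = w \<longrightarrow> cmod a \<le> cmod p)" by auto
  then have "innermost w \<in> P \<and> sgn (innermost w) = w \<and> (\<forall>p\<in>P. sgn p = w \<longrightarrow> cmod (innermost w) \<le> cmod p)"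
    unfolding innermost_def by (rule someI_ex)
  then show "innermost w \<in> P" "sgn (innermost w) = w" "\<And>p. p \<in> P \<Longrightarrow> sgn p = w \<Longrightarrow> cmod (innermost w) \<le> cmod p"
    by auto
qed

lemma sgn_P_dirs: "p \<in> P \<Longrightarrow> sgn p \<in> dirs"
  using sgn_in_dirs P_triod P_nonzero by blast

lemma next_dir_met: "w \<in> sgn ` P \<Longrightarrow> next_dir w \<in> sgn ` P"
  unfolding next_dir_def using innermost fP by blast

lemma innermost_in_segment:
  assumes "p \<in> P" shows "innermost (sgn p) \<in> closed_segment 0 p"
  using in_radial_iff[OF P_triod[OF assms], of "innermost (sgn p)"] innermost[of "sgn p"] assms P_triod by auto

lemma coord_less: "v \<in> P \<Longrightarrow> x \<in> closed_segment 0 v \<Longrightarrow> x \<noteq> 0 \<Longrightarrow> coord (sgn x) (f x) < cmod x"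
  by (rule coord_less_if_no_fixed_point[OF cont maps nofix cyc])

lemma next_dir_neq:
  assumes w: "w \<in> sgn ` P" shows "next_dir w \<noteq> w"
proof
  assume a: "next_dir w = w"
  note i = innermost[OF w]
  have fi: "f (innermost w) \<in> P" using i fP by blast
  have "coord w (f (innermost w)) < cmod (innermost w)"
    using coord_less[OF i(1), of "innermost w"] i P_nonzero by auto
  moreover have "coord w (f (innermost w)) = cmod (f (innermost w))"
    using coord_eq[OF P_triod[OF fi], of w] sgn_P_dirs[OF i(1)] i a by (simp add: next_dir_def)
  ultimately show False using i(3)[OF fi] a by (simp add: next_dir_def)
qed

lemma segment_subset_f_image:
  assumes K: "connected K" "K \<subseteq> tree" "0 \<in> K" "p \<in> K" "f p \<in> P"
  shows "closed_segment 0 (f p) \<subseteq> f ` K"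
proof -
  have "connected (f ` K)" using connected_funpow[OF K(1,2), of 1] by simp
  moreover have "f ` K \<subseteq> triod" using K maps tree_triod by blast
  moreover have "0 \<in> f ` K" "f p \<in> f ` K" using K f0 by (metis imageI)+
  ultimately show ?thesis
    using arc_subset_connected[of "f ` K" 0 "f p"] segment_eq_arc[OF P_triod[OF K(5)], of 0] by auto
qed

text \<open>
  Suppose that the edges at \<open>0\<close> of directions \<open>w\<close> and \<open>j\<close> were exchanged. Retract to the branch of
  direction \<open>j\<close> after the first application of \<open>f\<close>, and to that of direction \<open>w\<close> after the second.
  The resulting function of the radius is not below the diagonal at a point \<open>x\<close> that \<open>f\<close> maps to
  \<open>innermost j\<close>, and not above it at the outermost point of \<open>P\<close> on the branch. So it has a positive
  fixed point, which is a true point of period 2 on two branches, because both retractions send all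
  other branches to the fixed point \<open>0\<close>.
\<close>

lemma next_dir_next_dir_neq:
  assumes w: "w \<in> sgn ` P" shows "next_dir (next_dir w) \<noteq> w"
proof
  assume bk: "next_dir (next_dir w) = w"
  define j where "j = next_dir w"
  have jm: "j \<in> sgn ` P" unfolding j_def by (rule next_dir_met[OF w])
  note a = innermost[OF w] and b = innermost[OF jm]
  have wd: "w \<in> dirs" and jd: "j \<in> dirs" using w jm sgn_P_dirs by auto
  let ?K = "closed_segment 0 (innermost w)"
  have KT: "?K \<subseteq> tree" using a(1) unfolding tree_eq by blast
  have fa: "f (innermost w) \<in> P" "sgn (f (innermost w)) = j" using a fP by (auto simp: j_def next_dir_def)
  have "innermost j \<in> closed_segment 0 (f (innermost w))" using innermost_in_segment[OF fa(1)] fa by simp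
  also have "\<dots> \<subseteq> f ` ?K" using segment_subset_f_image[of ?K "innermost w"] KT fa by auto
  finally obtain x where x: "x \<in> ?K" "innermost j = f x" by blast
  have x0: "x \<noteq> 0" using x(2) P_nonzero[OF b(1)] by auto
  have xt: "x \<in> triod" "sgn x = w" "cmod x \<le> cmod (innermost w)"
    using radial_subset_triod[OF P_triod[OF a(1)] x(1)] x0 a by auto
  let ?A = "{p \<in> P. sgn p = w}"
  have "finite ?A" "innermost w \<in> ?A" using finite_P a by auto
  then obtain e where e: "e \<in> ?A" "\<And>p. p \<in> ?A \<Longrightarrow> cmod p \<le> cmod e"
    using ex_max_norm[of ?A] by blast
  have et: "e \<in> triod" "f e \<in> P" "f (f e) \<in> P" using e P_triod fP by auto
  let ?r = "\<lambda>t. of_real (coord j (f (of_real t * w))) * j"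
  let ?G = "\<lambda>t. coord w (f (?r t))"
  have rt: "?r t \<in> triod" if "0 \<le> t" "t \<le> 1" for t
    using coord_point[OF maps[OF ray_point(1)[OF wd that]] jd] zero_in_triod maps[OF ray_point(1)[OF wd that]] by auto
  have "\<exists>t. cmod x \<le> t \<and> t \<le> cmod e \<and> ?G t = t"
  proof (rule ivt_fixed_point)
    show "cmod x \<le> cmod e" using e(2)[of "innermost w"] a xt by auto
    have e1: "cmod e \<le> 1" by (rule triod_norm_le_1[OF et(1)])
    have "continuous_on (?r ` {cmod x..cmod e}) f"
    proof (rule continuous_on_subset[OF cont])
      show "?r ` {cmod x..cmod e} \<subseteq> triod"
      proof (rule image_subsetI)
        fix t assume t: "t \<in> {cmod x..cmod e}"
        have "0 \<le> t" "t \<le> 1" using t e1 norm_ge_zero[of x] unfolding atLeastAtMost_iff by linarith+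
        then show "?r t \<in> triod" by (rule rt)
      qed
    qed
    moreover have "continuous_on {cmod x..cmod e} ?r"
      by (intro continuous_intros continuous_coord_ray[OF cont wd]) (use e1 in auto)
    ultimately have "continuous_on {cmod x..cmod e} (\<lambda>t. f (?r t))"
      by (rule continuous_on_compose2) auto
    then show "continuous_on {cmod x..cmod e} ?G"
      unfolding coord_def[of w] by (intro continuous_intros)
    have "?r (cmod x) = innermost j"
      using sgn_eq_cases[OF xt(1,2)] coord_point[OF P_triod[OF b(1)] jd] b x by simp
    then have "?G (cmod x) = coord w (f (innermost j))" by simp
    also have "\<dots> = cmod (f (innermost j))"
      using coord_eq[OF P_triod[OF fP[OF b(1)]] wd] bk by (simp add: next_dir_def j_def)
    also have "\<dots> \<ge> cmod (innermost w)"
      using a(3)[OF fP[OF b(1)]] bk by (simp add: next_dir_def j_def)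
    finally show "cmod x \<le> ?G (cmod x)" using xt by simp
    have "?r (cmod e) = (if sgn (f e) = j then f e else 0)"
      using sgn_eq_cases[OF et(1), of w] coord_point[OF P_triod[OF et(2)] jd] e by simp
    then show "?G (cmod e) \<le> cmod e"
      using coord_eq[OF P_triod[OF et(3)] wd] e(2)[of "f (f e)"] et by auto
  qed
  then obtain t where t: "cmod x \<le> t" "t \<le> cmod e" "?G t = t" by blast
  have t01: "0 < t" "t \<le> 1"
    using t(1,2) triod_norm_le_1[OF et(1)] x0 zero_less_norm_iff[of x] by linarith+
  note r = ray_point[OF wd less_imp_le[OF t01(1)] t01(2)]
  define z where "z = of_real t * w"
  have zt: "z \<in> triod" using r z_def by simp
  have ne: "sgn (f z) = j"
  proof (rule ccontr)
    assume "sgn (f z) \<noteq> j"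
    then have "?r t = 0" using coord_point[OF maps[OF zt] jd] by (simp add: z_def)
    then have "?G t = 0" by (simp only: f0 coord_zero)
    then show False using t t01 by simp
  qed
  then have "?r t = f z" using coord_point[OF maps[OF zt] jd] by (simp add: z_def)
  then have "coord w (f (f z)) = t" using t(3) by simp
  then have "f (f z) = z"
    using coord_fixed[OF wd t01(1) maps[OF maps[OF zt]]] by (simp add: z_def)
  then have "sgn (f z) = sgn z" using no_primitive_2_cycle zt by blast
  moreover have "sgn z = w" using r(3) t01 by (simp add: z_def)
  ultimately show False using ne next_dir_neq[OF w] j_def by simp
qed

text \<open>
  The directions occurring in \<open>P\<close> are mapped to each other without fixed points and without
  2-cycles; so there are at least three of them, and they are permuted cyclically.
\<close>

lemma dirs_eq_orbit:
  assumes "w \<in> dirs"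
  shows "w \<in> sgn ` P" "dirs = {w, next_dir w, next_dir (next_dir w)}" "next_dir (next_dir (next_dir w)) = w"
proof -
  have *: "dirs = {u, next_dir u, next_dir (next_dir u)} \<and> next_dir (next_dir (next_dir u)) = u" if u: "u \<in> sgn ` P" for u
  proof -
    let ?S = "{u, next_dir u, next_dir (next_dir u)}"
    have m: "u \<in> sgn ` P" "next_dir u \<in> sgn ` P" "next_dir (next_dir u) \<in> sgn ` P" "next_dir (next_dir (next_dir u)) \<in> sgn ` P"
      using u next_dir_met by auto
    have sub: "sgn ` P \<subseteq> dirs" using sgn_P_dirs by auto
    have "next_dir u \<noteq> u" "next_dir (next_dir u) \<noteq> next_dir u" "next_dir (next_dir u) \<noteq> u"
      using next_dir_neq next_dir_next_dir_neq m by auto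
    then have "card ?S = 3" by auto
    moreover have "?S \<subseteq> dirs" using m sub by auto
    ultimately have d: "dirs = ?S" using card_subset_eq[OF finite_dirs, of ?S] card_dirs by simp
    moreover have "next_dir (next_dir (next_dir u)) \<in> ?S" using m(4) sub d by blast
    ultimately show ?thesis using next_dir_neq[OF m(3)] next_dir_next_dir_neq[OF m(2)] by auto
  qed
  obtain p where "p \<in> P" using is_cycle_nonempty[OF cyc] by blast
  then have p: "sgn p \<in> sgn ` P" by simp
  then have "w \<in> {sgn p, next_dir (sgn p), next_dir (next_dir (sgn p))}" using * assms by simp
  then show "w \<in> sgn ` P"
    using p next_dir_met[OF p] next_dir_met[OF next_dir_met[OF p]] by (elim insertE emptyE) simp_all
  then show "dirs = {w, next_dir w, next_dir (next_dir w)}" "next_dir (next_dir (next_dir w)) = w"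
    using * by auto
qed

lemma next_dir_dirs: "w \<in> dirs \<Longrightarrow> next_dir w \<in> dirs"
  using dirs_eq_orbit by blast

abbreviation stem :: "complex \<Rightarrow> complex set" where
  "stem w \<equiv> closed_segment 0 (innermost w)"

lemma stem_subset: "w \<in> dirs \<Longrightarrow> stem w \<subseteq> tree"
  using innermost(1)[OF dirs_eq_orbit(1)] unfolding tree_eq by blast

lemma stem_subset_segment: "p \<in> P \<Longrightarrow> stem (sgn p) \<subseteq> closed_segment 0 p"
  using innermost_in_segment by (simp add: subset_closed_segment)

lemma stem_step:
  assumes w: "w \<in> dirs" shows "stem (next_dir w) \<subseteq> f ` stem w"
proof -
  note i = innermost[OF dirs_eq_orbit(1)[OF w]]
  have fi: "f (innermost w) \<in> P" by (rule fP[OF i(1)])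
  have "stem (next_dir w) \<subseteq> closed_segment 0 (f (innermost w))"
    using stem_subset_segment[OF fi] by (simp add: next_dir_def)
  also have "\<dots> \<subseteq> f ` stem w"
    using segment_subset_f_image[OF _ stem_subset[OF w], of "innermost w"] fi by auto
  finally show ?thesis .
qed

text \<open>
  Let \<open>S w\<close> be the union of the images of the edge at \<open>0\<close> of direction \<open>w\<close> under the iterates of
  \<open>f ^^ 3\<close>; these images increase, and \<open>f\<close> maps \<open>S w\<close> into \<open>S (next_dir w)\<close>. The point \<open>innermost w\<close>
  at some time sits on a branch other than that of the rotated edge, so that some \<open>S w1\<close> contains the
  edge at \<open>0\<close> of another direction \<open>w2\<close>, and therefore \<open>S w2\<close>. Rotating this inclusion shows that all
  three sets are equal. Their common value is invariant and contains \<open>P\<close>; as \<open>P\<close> is finite, a single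
  iterate suffices.
\<close>

lemma stem_covers:
  assumes nonrot: "\<exists>p\<in>P. sgn (f p) \<noteq> next_dir (sgn p)" and w: "w \<in> dirs"
  shows "\<exists>n. (f ^^ n) ` stem w = tree"
proof -
  have connected_UN_common: "connected (\<Union>k. A k)"
    if "\<And>k. connected (A k)" "\<And>k. z \<in> A k" for A :: "nat \<Rightarrow> complex set" and z
  proof (rule connected_Union)
    have "z \<in> \<Inter> (range A)" using that by blast
    then show "\<Inter> (range A) \<noteq> {}" by blast
  qed (use that in auto)
  define S where "S w = (\<Union>k. (f ^^ (3 * k)) ` stem w)" for w
  have stem2: "stem w \<subseteq> (f ^^ 2) ` stem (next_dir w)" if w: "w \<in> dirs" for w
  proof -
    have "stem (next_dir (next_dir (next_dir w))) \<subseteq> f ` stem (next_dir (next_dir w))"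
      by (intro stem_step next_dir_dirs w)
    also have "\<dots> \<subseteq> f ` f ` stem (next_dir w)"
      by (intro image_mono stem_step next_dir_dirs w)
    finally show ?thesis using dirs_eq_orbit(3)[OF w] by (simp add: numeral_2_eq_2 image_comp)
  qed
  have stem3: "stem w \<subseteq> (f ^^ 3) ` stem w" if w: "w \<in> dirs" for w
  proof -
    have "stem w \<subseteq> (f ^^ 2) ` stem (next_dir w)" by (rule stem2[OF w])
    also have "\<dots> \<subseteq> (f ^^ 2) ` f ` stem w" by (intro image_mono stem_step w)
    also have "\<dots> = (f ^^ 3) ` stem w"
      by (simp add: image_comp numeral_2_eq_2 numeral_3_eq_3 comp_assoc)
    finally show ?thesis .
  qed
  have fS: "f x \<in> S (next_dir w)" if w: "w \<in> dirs" and x: "x \<in> S w" for x w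
  proof -
    obtain k where k: "x \<in> (f ^^ (3 * k)) ` stem w" using x by (auto simp: S_def)
    then have "x \<in> (f ^^ (3 * k)) ` (f ^^ 2) ` stem (next_dir w)" using stem2[OF w] by blast
    then have "f x \<in> f ` (f ^^ (3 * k)) ` (f ^^ 2) ` stem (next_dir w)" by blast
    also have "\<dots> = (f ^^ (1 + 3 * k + 2)) ` stem (next_dir w)"
      unfolding funpow_add by (simp add: image_comp comp_assoc)
    also have "1 + 3 * k + 2 = 3 * Suc k" by simp
    finally show ?thesis unfolding S_def by blast
  qed
  have fnS: "(next_dir ^^ k) w \<in> dirs \<and> (f ^^ k) x \<in> S ((next_dir ^^ k) w)" if "w \<in> dirs" "x \<in> S w" for x w k
    by (induction k) (use that fS next_dir_dirs in auto)
  have id3: "(next_dir ^^ (3 * k)) w = w" if "w \<in> dirs" for w k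
  proof (induction k)
    case (Suc k)
    have "3 * Suc k = 3 + 3 * k" by simp
    then have "(next_dir ^^ (3 * Suc k)) w = (next_dir ^^ 3) ((next_dir ^^ (3 * k)) w)"
      by (simp only: funpow_add comp_apply)
    then show ?case using Suc dirs_eq_orbit(3)[OF that] by (simp add: numeral_3_eq_3)
  qed simp
  have stemS: "stem w \<subseteq> S w" for w
    unfolding S_def using UN_upper[of 0 UNIV "\<lambda>k. (f ^^ (3 * k)) ` stem w"] by simp
  have zero_funpow: "(f ^^ k) 0 = 0" for k by (induction k) auto
  have zero_img: "0 \<in> (f ^^ k) ` stem w" for k w
    using zero_funpow[of k] by (metis ends_in_segment(1) imageI)
  have connS: "connected (S w)" "S w \<subseteq> triod" if w: "w \<in> dirs" for w
  proof -
    show "connected (S w)" unfolding S_def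
      using connected_funpow[OF _ stem_subset[OF w]] zero_img by (intro connected_UN_common[of _ 0]) auto
    show "S w \<subseteq> triod" unfolding S_def using stem_subset[OF w] funpow_tree tree_triod by blast
  qed
  have PS: "stem (sgn p) \<subseteq> S w" if w: "w \<in> dirs" and p: "p \<in> P" "p \<in> S w" for p w
  proof -
    have "triod_arc 0 p \<subseteq> S w"
      using arc_subset_connected[OF connS[OF w]] stemS[of w] p(2) by auto
    then show ?thesis using stem_subset_segment[OF p(1)] segment_eq_arc[OF P_triod[OF p(1)], of 0] by auto
  qed
  have incl: "S w' \<subseteq> S w" if w: "w \<in> dirs" and g: "stem w' \<subseteq> S w" for w w'
  proof
    fix x assume "x \<in> S w'"
    then obtain k y where y: "x = (f ^^ (3 * k)) y" "y \<in> stem w'" by (auto simp: S_def)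
    then show "x \<in> S w" using fnS[OF w, of y "3 * k"] g id3[OF w] by auto
  qed
  have shift: "stem (next_dir w') \<subseteq> S (next_dir w)" if "w \<in> dirs" "w' \<in> dirs" "stem w' \<subseteq> S w" for w w'
    using stem_step[OF that(2)] that(3) fS[OF that(1)] by blast
  note i = innermost[OF dirs_eq_orbit(1)[OF w]]
  have "innermost w \<in> S w" using stemS by auto
  then have orb: "(next_dir ^^ k) w \<in> dirs" "(f ^^ k) (innermost w) \<in> S ((next_dir ^^ k) w)" for k
    using fnS[OF w] by blast+
  have "\<exists>k. sgn ((f ^^ k) (innermost w)) \<noteq> (next_dir ^^ k) w"
  proof (rule ccontr)
    assume "\<not> ?thesis"
    then have rot: "sgn ((f ^^ k) (innermost w)) = (next_dir ^^ k) w" for k by simp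
    obtain p where p: "p \<in> P" "sgn (f p) \<noteq> next_dir (sgn p)" using nonrot by blast
    then obtain k where "p = (f ^^ k) (innermost w)" using is_cycle_transitive[OF cyc i(1)] by blast
    then show False using p(2) rot[of k] rot[of "Suc k"] by simp
  qed
  then obtain k where k: "sgn ((f ^^ k) (innermost w)) \<noteq> (next_dir ^^ k) w" by blast
  define w1 where "w1 = (next_dir ^^ k) w"
  define w2 where "w2 = sgn ((f ^^ k) (innermost w))"
  have fkP: "(f ^^ k) (innermost w) \<in> P" by (rule is_cycle_funpow[OF cyc i(1)])
  have w1: "w1 \<in> dirs" using orb w1_def by simp
  have g12: "stem w2 \<subseteq> S w1"
    using PS[OF _ fkP] orb[of k] by (simp add: w1_def w2_def)
  have "w2 \<in> dirs" "w2 \<noteq> w1" using sgn_P_dirs[OF fkP] k by (auto simp: w1_def w2_def)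
  then have w2: "w2 = next_dir w1 \<or> w2 = next_dir (next_dir w1)"
    using dirs_eq_orbit(2)[OF w1] by blast
  let ?a = "w1" and ?b = "next_dir w1" and ?c = "next_dir (next_dir w1)"
  have abc: "?a \<in> dirs" "?b \<in> dirs" "?c \<in> dirs" "next_dir ?c = ?a"
    using w1 next_dir_dirs dirs_eq_orbit(3)[OF w1] by auto
  have "S ?a = S ?b \<and> S ?b = S ?c"
    using w2
  proof
    assume "w2 = ?b"
    then have g: "stem ?b \<subseteq> S ?a" using g12 by simp
    have g': "stem ?c \<subseteq> S ?b" using shift[OF abc(1,2) g] .
    have g'': "stem ?a \<subseteq> S ?c" using shift[OF abc(2,3) g'] abc(4) by simp
    show ?thesis using incl[OF abc(1) g] incl[OF abc(2) g'] incl[OF abc(3) g''] by blast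
  next
    assume "w2 = ?c"
    then have g: "stem ?c \<subseteq> S ?a" using g12 by simp
    have g': "stem ?a \<subseteq> S ?b" using shift[OF abc(1,3) g] abc(4) by simp
    have g'': "stem ?b \<subseteq> S ?c" using shift[OF abc(2,1) g'] .
    show ?thesis using incl[OF abc(1) g] incl[OF abc(2) g'] incl[OF abc(3) g''] by blast
  qed
  then have "\<forall>v\<in>{?a, ?b, ?c}. S v = S ?a" by simp
  then have "\<forall>v\<in>dirs. S v = S ?a" by (simp only: dirs_eq_orbit(2)[OF w1, symmetric])
  then have Seq: "S u = S w" if "u \<in> dirs" for u
    using that w by simp
  have "f ` S w \<subseteq> S w"
    using fS[OF w] Seq[OF next_dir_dirs[OF w]] by blast
  then have PSw: "P \<subseteq> S w"
    using is_cycle_orbit[OF cyc i(1)] stemS[of w] by auto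
  have mono: "(f ^^ (3 * k)) ` stem w \<subseteq> (f ^^ (3 * l)) ` stem w" if "k \<le> l" for k l
  proof (rule lift_Suc_mono_le[of "\<lambda>k. (f ^^ (3 * k)) ` stem w", OF _ that])
    fix k
    have "(f ^^ (3 * k)) ` stem w \<subseteq> (f ^^ (3 * k)) ` (f ^^ 3) ` stem w"
      by (intro image_mono stem3 w)
    also have "\<dots> = (f ^^ (3 * k + 3)) ` stem w" by (simp add: funpow_add image_comp)
    finally show "(f ^^ (3 * k)) ` stem w \<subseteq> (f ^^ (3 * Suc k)) ` stem w" by (simp add: add.commute)
  qed
  have "\<forall>p\<in>P. \<exists>k. p \<in> (f ^^ (3 * k)) ` stem w" using PSw unfolding S_def by blast
  then obtain kk where kk: "\<And>p. p \<in> P \<Longrightarrow> p \<in> (f ^^ (3 * kk p)) ` stem w" by metis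
  define N where "N = Max (kk ` P)"
  have "P \<subseteq> (f ^^ (3 * N)) ` stem w"
  proof
    fix p assume p: "p \<in> P"
    then have "kk p \<le> N" unfolding N_def using finite_P by simp
    then show "p \<in> (f ^^ (3 * N)) ` stem w" using kk[OF p] mono by blast
  qed
  then have "(f ^^ (3 * N)) ` stem w = tree"
    using connected_funpow[OF _ stem_subset[OF w]] zero_img stem_subset[OF w] funpow_tree
    by (intro connected_eq_tree) auto
  then show ?thesis by blast
qed

text \<open>
  The three branches themselves form the family; a branch with two points of \<open>P\<close> exists because \<open>P\<close>
  is not primitive.
\<close>

lemma has_block_structure_if_rotating:
  assumes rot: "\<And>p. p \<in> P \<Longrightarrow> sgn (f p) = next_dir (sgn p)"
    and notprim: "\<not> primitive_cycle P"
  shows "has_block_structure f P"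
proof -
  let ?C = "\<lambda>x. {z \<in> triod - {0}. sgn z = sgn x}"
  obtain p q where pq: "p \<in> P" "q \<in> P" "p \<noteq> q" "\<exists>B\<in>branches. p \<in> B \<and> q \<in> B"
    using notprim by (auto simp: primitive_cycle_def)
  then have s: "sgn p = sgn q" using same_branch_iff P_triod by blast
  have PC: "x \<in> triod - {0}" if "x \<in> P" for x using that is_cycle_subset[OF cyc] by blast
  show ?thesis
  proof (rule has_block_structure_if_family[of ?C p q])
    show "connected (?C x)" if "x \<in> P" for x
      using branch_of[OF PC[OF that]] connected_connected_component[of "triod - {0}" x] by simp
    show "f y \<in> ?C (f x)" if "x \<in> P" "y \<in> P" "y \<in> ?C x" for x y
      using rot that PC[OF fP] by auto
    show "\<And>x y. x \<in> P \<Longrightarrow> y \<in> P \<Longrightarrow> ?C x \<inter> ?C y \<noteq> {} \<Longrightarrow> ?C x = ?C y" by auto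
  qed (use pq s PC in auto)
qed

section \<open>Exactness\<close>

text \<open>
  An open set contains an arc, and the images of an arc run into \<open>0\<close>: a vertex \<open>p\<close> occurs in one of
  them, and unless \<open>0\<close> occurs later, the union of all later images would join two points of \<open>P\<close>
  away from \<open>0\<close>. From \<open>0\<close> and one more point on, the images grow until they contain an edge at \<open>0\<close>,
  and then cover the tree.
\<close>

lemma exact_if_no_block_structure:
  assumes notprim: "\<not> primitive_cycle P" and nb: "\<not> has_block_structure f P"
  shows "topologically_exact tree f"
proof -
  \<comment> \<open>vertices separate the images of any two points sooner or later\<close>
  have sep: "\<exists>n. \<exists>p\<in>verts. p \<in> triod_arc ((f ^^ n) x) ((f ^^ n) y) \<and> p \<noteq> (f ^^ n) x \<and> p \<noteq> (f ^^ n) y"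
    if xy: "x \<in> tree" "y \<in> tree" "x \<noteq> y" for x y
  proof -
    have "\<exists>n. \<not> unseparated ((f ^^ n) x) ((f ^^ n) y)"
      using unseparated_forever_imp_edge_loop[OF xy] has_block_structure_if_edge_loop[OF notprim] nb by blast
    then show ?thesis unfolding unseparated_def by blast
  qed
  have nonrot: "\<exists>p\<in>P. sgn (f p) \<noteq> next_dir (sgn p)"
    using has_block_structure_if_rotating notprim nb by blast
  have zero: "(f ^^ n) 0 = 0" for n by (induction n) auto
  have fn: "(f ^^ n) ` K \<subseteq> tree" if "K \<subseteq> tree" for n K using that funpow_tree by blast
  have arcK: "triod_arc a b \<subseteq> K" if "connected K" "K \<subseteq> tree" "a \<in> K" "b \<in> K" for a b K
    using arc_subset_connected[OF that(1) _ that(3,4)] that(2) tree_triod by blast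
  have tree_above: "(f ^^ n) ` K = tree" if "stem w \<subseteq> K" "K \<subseteq> tree" "(f ^^ n) ` stem w = tree" for n K w
    using image_mono[OF that(1), of "f ^^ n"] fn[OF that(2), of n] that(3) by blast
  \<comment> \<open>a vertex that separates \<open>0\<close> from an image of \<open>z\<close> lies beyond an entire edge at \<open>0\<close>\<close>
  have cover: "\<exists>n. (f ^^ n) ` K = tree"
    if K: "connected K" "K \<subseteq> tree" "0 \<in> K" "z \<in> K" "z \<noteq> 0" for K z
  proof -
    have T: "0 \<in> tree" "z \<in> tree" using K by auto
    obtain n p where p: "p \<in> verts" "p \<in> triod_arc 0 ((f ^^ n) z)" "p \<noteq> 0"
      using sep[OF T] K(5) zero by metis
    then have pP: "p \<in> P" by simp
    let ?K = "(f ^^ n) ` K"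
    have K': "connected ?K" "?K \<subseteq> tree" using connected_funpow[OF K(1,2)] fn[OF K(2)] by auto
    have in0: "0 \<in> ?K" "(f ^^ n) z \<in> ?K" using K(3,4) zero[of n] by (metis imageI)+
    have "p \<in> ?K" using arcK[OF K' in0] p(2) by blast
    then have "triod_arc 0 p \<subseteq> ?K" using arcK[OF K' in0(1)] by blast
    then have "stem (sgn p) \<subseteq> ?K"
      using stem_subset_segment[OF pP] segment_eq_arc[OF P_triod[OF pP], of 0] by auto
    moreover obtain m where "(f ^^ m) ` stem (sgn p) = tree"
      using stem_covers[OF nonrot sgn_P_dirs[OF pP]] by blast
    ultimately have "(f ^^ m) ` ?K = tree" using tree_above K'(2) by blast
    then have "(f ^^ (m + n)) ` K = tree" by (simp add: funpow_add image_comp)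
    then show ?thesis by blast
  qed
  \<comment> \<open>by \<open>cover\<close> it is enough that some image of \<open>K\<close> contains \<open>0\<close> and another point\<close>
  have arcs: "\<exists>n. (f ^^ n) ` K = tree" if K: "connected K" "K \<subseteq> tree" "x \<in> K" "y \<in> K" "x \<noteq> y" for K x y
  proof -
    have T: "x \<in> tree" "y \<in> tree" using K by auto
    obtain n p where p: "p \<in> verts" "p \<in> triod_arc ((f ^^ n) x) ((f ^^ n) y)" "p \<noteq> (f ^^ n) x"
      using sep[OF T K(5)] by blast
    let ?K = "(f ^^ n) ` K" and ?x = "(f ^^ n) x"
    have K1: "connected ?K" "?K \<subseteq> tree" using connected_funpow[OF K(1,2)] fn[OF K(2)] by auto
    have xK: "?x \<in> ?K" "p \<in> ?K" using arcK[OF K1, of ?x "(f ^^ n) y"] K(3,4) p(2) by auto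
    have "\<exists>k. 0 \<in> (f ^^ k) ` ?K \<and> (\<exists>z\<in>(f ^^ k) ` ?K. z \<noteq> 0)"
    proof (cases "p = 0")
      case True
      then show ?thesis using xK p(3) by (intro exI[of _ 0]) auto
    next
      case False
      then have pP: "p \<in> P" using p(1) by simp
      define X where "X = (\<Union>k. (f ^^ k) ` ?K)"
      have "0 \<in> X"
      proof (rule ccontr)
        assume X0: "0 \<notin> X"
        have XT: "X \<subseteq> triod - {0}" using X0 fn[OF K1(2)] tree_triod unfolding X_def by blast
        have fX: "f ` X \<subseteq> X"
        proof (rule image_subsetI)
          fix z assume "z \<in> X"
          then obtain k where "z \<in> (f ^^ k) ` ?K" unfolding X_def by blast
          then have "f z \<in> (f ^^ Suc k) ` ?K" by auto
          then show "f z \<in> X" unfolding X_def by blast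
        qed
        have "p \<in> tree" "?x \<in> tree" using xK K1 by auto
        then obtain l q where q: "q \<in> verts" "q \<in> triod_arc ((f ^^ l) p) ((f ^^ l) ?x)" "q \<noteq> (f ^^ l) p"
          using sep[of p ?x] p(3) by metis
        let ?L = "(f ^^ l) ` ?K"
        have L: "connected ?L" "?L \<subseteq> tree" using connected_funpow[OF K1] fn[OF K1(2)] by auto
        have pL: "(f ^^ l) p \<in> ?L" "(f ^^ l) ?x \<in> ?L" using xK by (metis imageI)+
        have qL: "q \<in> ?L" using arcK[OF L pL] q(2) by blast
        have LX: "?L \<subseteq> X" unfolding X_def by blast
        have "q \<in> X" using qL LX by (rule rev_subsetD)
        then have "q \<in> P" using q(1) X0 by auto
        moreover have "connected_component X ((f ^^ l) p) q"
          unfolding connected_component_def using L(1) LX pL(1) qL by blast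
        ultimately show False
          using has_block_structure_if_invariant_set[OF XT fX is_cycle_funpow[OF cyc pP, of l], of q] q(3) nb by blast
      qed
      then obtain k where k: "0 \<in> (f ^^ k) ` ?K" unfolding X_def by blast
      moreover have "(f ^^ k) p \<in> (f ^^ k) ` ?K" using xK(2) by (rule imageI)
      moreover have "(f ^^ k) p \<noteq> 0" using P_nonzero is_cycle_funpow[OF cyc pP] by blast
      ultimately show ?thesis by blast
    qed
    then obtain k z where k: "0 \<in> (f ^^ k) ` ?K" "z \<in> (f ^^ k) ` ?K" "z \<noteq> 0" by blast
    have "connected ((f ^^ k) ` ?K)" "(f ^^ k) ` ?K \<subseteq> tree"
      using connected_funpow[OF K1] fn[OF K1(2)] by auto
    then obtain m where "(f ^^ m) ` (f ^^ k) ` ?K = tree" using cover k by blast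
    then have "(f ^^ (m + k + n)) ` K = tree" by (simp add: funpow_add image_comp comp_assoc)
    then show ?thesis by blast
  qed
  show ?thesis
    unfolding topologically_exact_def
  proof (intro allI impI)
    fix U assume U: "openin (top_of_set tree) U \<and> U \<noteq> {}"
    then obtain u where u: "u \<in> U" by blast
    have UT: "U \<subseteq> tree" using U openin_imp_subset by blast
    obtain r where r: "r > 0" "ball u r \<inter> tree \<subseteq> U"
      using U u unfolding openin_contains_ball by meson
    obtain v where v: "v \<in> P" "u \<in> closed_segment 0 v" using u UT unfolding tree_eq by blast
    have "closed_segment 0 v \<noteq> {u}"
      using P_nonzero[OF v(1)] by (metis ends_in_segment singletonD)
    then have "u islimpt closed_segment 0 v"
      using v(2) by (intro connected_imp_perfect) auto
    then obtain u' where u': "u' \<in> closed_segment 0 v" "u' \<noteq> u" "dist u' u < r"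
      using r(1) unfolding islimpt_approachable by blast
    let ?K = "closed_segment u u'"
    have "?K \<subseteq> closed_segment 0 v" using v u' by (simp add: subset_closed_segment)
    then have KT: "?K \<subseteq> tree" using v(1) unfolding tree_eq by blast
    have "?K \<subseteq> ball u r"
      using u' r(1) by (intro closed_segment_subset) (auto simp: dist_commute)
    then have KU: "?K \<subseteq> U" using r KT by blast
    obtain n where n: "(f ^^ n) ` ?K = tree" using arcs[of ?K u u'] KT u' by auto
    have "(f ^^ n) ` U = tree"
      using image_mono[OF KU, of "f ^^ n"] fn[OF UT, of n] n by blast
    then show "\<exists>n. (f ^^ n) ` U = tree" by blast
  qed
qed

end

theorem theorem3p7:
  fixes f :: "complex \<Rightarrow> complex" and P :: "complex set"
  assumes "f \<in> regular_maps"
    and "is_cycle f P"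
    and "P_linear P f"
    and "\<not> primitive_cycle P"
  shows "topologically_exact (triod_hull P) f \<longleftrightarrow> \<not> has_block_structure f P"
proof -
  have U: "continuous_on triod f" "f ` triod \<subseteq> triod" "{z \<in> triod. f z = z} = {0}"
    using assms(1) by (auto simp: regular_maps_def triod_maps_def)
  have maps: "\<And>x. x \<in> triod \<Longrightarrow> f x \<in> triod" and nofix: "\<And>x. x \<in> triod \<Longrightarrow> f x = x \<Longrightarrow> x = 0"
    using U by auto
  interpret regular_linear_cycle f P
  proof
    show "\<exists>x\<in>P. \<exists>y\<in>P. sgn x \<noteq> sgn y"
      by (rule cycle_meets_two_branches[OF U(1) maps nofix assms(2)])
    show "\<And>x. x \<in> triod \<Longrightarrow> f (f x) = x \<Longrightarrow> sgn (f x) = sgn x"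
      by (rule regular_map_no_primitive_2_cycle[OF assms(1)])
  qed (use assms nofix in auto)
  show ?thesis
    using exact_if_no_block_structure[OF assms(4)] not_exact_if_block_structure by blast
qed

end
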